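(* Let $f$ be a real continuous function on $[0,2\pi]$ with modulus of continuity $\lambda(f,\delta)=o(\delta^{1/2})$ as $\delta\to0$. Let $d\mu(x)=w(x)\,dx$ be a positive finite Borel measure on $[-1,1]$ satisfying the Szegő condition $\int_{-1}^1\frac{\log w(x)}{\sqrt{1-x^2}}\,dx>-\infty$ and such that $w(x)\sqrt{1-x^2}>0$ for all $x\in[-1,1]$ and $w(x)\sqrt{1-x^2}$ is analytic in an open set containing $[-1,1]$. For each $n$ let $x_1,\dots,x_n$ be the zeros of the monic orthogonal polynomial $P_n(x)$ of degree $n$ with respect to $\mu$, and let the nodal system $\{\theta_j\}_{j=1}^{2n}$ be given by $\theta_j=\arccos x_j$ with $0<\theta_j<\pi$ for $j=1,\dots,n$, and $\theta_{n+j}=2\pi-\theta_{n-j+1}$ for $j=1,\dots,n$. Then there is a Lagrange interpolation trigonometric polynomial $\tau_n(\theta)$ of degree $\le n$ such that $\tau_n(\theta_j)=f(\theta_j)$ for $j=1,\dots,2n$, and it satisfies $\lim_{n\to\infty}\tau_n(\theta)=f(\theta)$ uniformly on $[0,2\pi]$.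
   Context: The modulus of continuity of $f$ is $\lambda(f,\delta)=\sup\{|f(s)-f(t)|:s,t\in[0,2\pi],\ |s-t|<\delta\}$. The assumption on $w(x)\sqrt{1-x^2}$ means that there are an open set $U\subset\mathbb{C}$ containing $[-1,1]$ and an analytic function $h$ on $U$ with $h(x)>0$ for all $x\in[-1,1]$ and $h(x)=w(x)\sqrt{1-x^2}$ for $x\in(-1,1)$. A trigonometric polynomial of degree at most $n$ is a function $a_0+\sum_{k=1}^n(a_k\cos k\theta+b_k\sin k\theta)$ with real coefficients. The zeros of $P_n$ are simple and lie in $(-1,1)$.
   Formalization: The formal theorem adds the assumption f(0) = f(2π), which the stated conclusion forces because trigonometric polynomials are 2π-periodic; without it the claim fails, e.g. for f(θ) = θ. *)

theory Defs
  imports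
    "HOL-Analysis.Analysis"
    "HOL-Computational_Algebra.Polynomial"
    "HOL-Library.Landau_Symbols"
begin

definition modulus_of_continuity :: "(real \<Rightarrow> real) \<Rightarrow> real \<Rightarrow> real" where
  "modulus_of_continuity f \<delta> =
     Sup {\<bar>f s - f t\<bar> | s t. s \<in> {0..2*pi} \<and> t \<in> {0..2*pi} \<and> \<bar>s - t\<bar> < \<delta>}"

definition trig_poly :: "nat \<Rightarrow> (real \<Rightarrow> real) \<Rightarrow> bool" where
  "trig_poly n T \<longleftrightarrow>
     (\<exists>(a :: nat \<Rightarrow> real) b. \<forall>\<theta>.
        T \<theta> = a 0 + (\<Sum>k=1..n. a k * cos (real k * \<theta>) + b k * sin (real k * \<theta>)))"

definition weight_measure :: "(real \<Rightarrow> real) \<Rightarrow> real measure" where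
  "weight_measure w = density lborel (\<lambda>x. ennreal (w x) * indicator {-1..1} x)"

text \<open>
  The integral of \<open>log w / sqrt (1 - x\<^sup>2)\<close> exceeds minus infinity iff its negative part has a
  finite integral. The case distinction implements \<open>log 0 = -\<infinity>\<close>, whereas \<open>ln 0 = 0\<close> in HOL.
\<close>
definition szego_condition :: "(real \<Rightarrow> real) \<Rightarrow> bool" where
  "szego_condition w \<longleftrightarrow>
     (\<integral>\<^sup>+x\<in>{-1..1}. (if 0 < w x then ennreal (- ln (w x) / sqrt (1 - x^2)) else \<infinity>) \<partial>lborel) < \<infinity>"

text \<open>
  The product \<open>w x * sqrt (1 - x\<^sup>2)\<close> is compared with its analytic extension only on the open
  interval, because at the endpoints \<open>w\<close> is typically infinite; its values at \<open>1\<close> and \<open>-1\<close> are those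
  of the extension.
\<close>
definition positive_analytic_on_interval :: "(real \<Rightarrow> real) \<Rightarrow> bool" where
  "positive_analytic_on_interval w \<longleftrightarrow>
     (\<exists>U (h :: complex \<Rightarrow> complex).
        open U \<and> complex_of_real ` {-1..1} \<subseteq> U \<and> h analytic_on U \<and>
        (\<forall>x\<in>{-1..1}. h (complex_of_real x) \<in> \<real> \<and> 0 < Re (h (complex_of_real x))) \<and>
        (\<forall>x\<in>{-1<..<1}. h (complex_of_real x) = complex_of_real (w x * sqrt (1 - x^2))))"

definition monic_orthogonal_poly :: "real measure \<Rightarrow> nat \<Rightarrow> real poly \<Rightarrow> bool" where
  "monic_orthogonal_poly \<mu> n p \<longleftrightarrow>
     degree p = n \<and> lead_coeff p = 1 \<and>
     (\<forall>q. degree q < n \<longrightarrow> (\<integral>x. poly p x * poly q x \<partial>\<mu>) = 0)"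

end

theory Submission imports Defs begin

text \<open>
  Split the interpolant into its even part \<open>p (cos t)\<close> and its odd part \<open>sin t * q (cos t)\<close>; both
  become Lagrange interpolation problems at the zeros of \<open>P\<^sub>n\<close>. With \<open>H t = w (cos t) * sin t\<close>, which
  is continuous and bounded below by some \<open>c > 0\<close> on \<open>[0, \<pi>]\<close>, Gauss quadrature bounds
  \<open>\<integral> (p\<^sup>2 + (1 - x\<^sup>2) q\<^sup>2) d\<mu>\<close> by \<open>\<mu>(\<real>)\<close> times the maximum of the squared data, and Nikolskii's
  inequality turns this mean square bound into a uniform bound at the price of a factor \<open>O(\<surd>n)\<close>. So the
  interpolation operator has norm \<open>O(\<surd>n)\<close>. Applying it to \<open>f - T\<close>, where \<open>T\<close> is a trigonometric
  polynomial of degree below \<open>n\<close> with \<open>|f - T| = O(\<lambda>(f, 1/n)) = o(n\<^sup>-\<^sup>1\<^sup>/\<^sup>2)\<close> by Jackson's theorem, gives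
  the claim.
\<close>

section \<open>Trigonometric polynomials and Nikolskii's inequality\<close>

text \<open>The family \<open>B\<close> and the index set \<open>A\<close> are parameters so that
  closure properties and the mean square bound are proved once and then used for cosines over
  \<open>{..n}\<close> and sines over \<open>{1..n}\<close>.\<close>

definition in_span :: "('i \<Rightarrow> real \<Rightarrow> real) \<Rightarrow> 'i set \<Rightarrow> (real \<Rightarrow> real) \<Rightarrow> bool" where
  "in_span B A f \<longleftrightarrow> (\<exists>a. \<forall>t. f t = (\<Sum>k\<in>A. a k * B k t))"

lemma in_span_base: "finite A \<Longrightarrow> k \<in> A \<Longrightarrow> in_span B A (B k)"
  unfolding in_span_def
  by (intro exI[of _ "\<lambda>j. if j = k then 1 else 0"]) (simp add: if_distrib if_distribR cong: if_cong)

lemma in_span_add: "in_span B A f \<Longrightarrow> in_span B A g \<Longrightarrow> in_span B A (\<lambda>t. f t + g t)"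
  unfolding in_span_def
proof (elim exE)
  fix a b assume "\<forall>t. f t = (\<Sum>k\<in>A. a k * B k t)" "\<forall>t. g t = (\<Sum>k\<in>A. b k * B k t)"
  then show "\<exists>c. \<forall>t. f t + g t = (\<Sum>k\<in>A. c k * B k t)"
    by (intro exI[of _ "\<lambda>k. a k + b k"]) (simp add: sum.distrib distrib_right)
qed

lemma in_span_cmult: "in_span B A f \<Longrightarrow> in_span B A (\<lambda>t. c * f t)"
  unfolding in_span_def
proof (elim exE)
  fix a assume "\<forall>t. f t = (\<Sum>k\<in>A. a k * B k t)"
  then show "\<exists>b. \<forall>t. c * f t = (\<Sum>k\<in>A. b k * B k t)"
    by (intro exI[of _ "\<lambda>k. c * a k"]) (simp add: sum_distrib_left mult.assoc)
qed

lemma in_span_sum: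
  "(\<And>i. i \<in> I \<Longrightarrow> in_span B A (f i)) \<Longrightarrow> in_span B A (\<lambda>t. \<Sum>i\<in>I. f i t)"
proof (induction I rule: infinite_finite_induct)
  case (insert x F)
  then show ?case using in_span_add[of B A "f x" "\<lambda>t. \<Sum>i\<in>F. f i t"] by simp
qed (auto simp: in_span_def intro!: exI[of _ "\<lambda>_. 0"])

lemma in_span_cong: "in_span B A f \<Longrightarrow> (\<And>t. f t = g t) \<Longrightarrow> in_span B A g"
  by (simp add: in_span_def)

text \<open>Induction in Horner form: \<open>p (cos t) = c + cos t * q (cos t)\<close>, and
  \<open>cos t * cos (k t)\<close> is the mean of the cosines of frequencies \<open>k + 1\<close>
  and \<open>k - 1\<close>, so each factor \<open>cos t\<close> raises the top frequency by
  one.\<close>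

lemma poly_cos_in_span:
  "degree p \<le> n \<Longrightarrow> in_span (\<lambda>k t. cos (real k * t)) {..n} (\<lambda>t. poly p (cos t))"
proof (induction n arbitrary: p)
  case 0
  then show ?case by (auto simp: in_span_def elim!: degree_eq_zeroE)
next
  case (Suc n)
  let ?S = "in_span (\<lambda>k t. cos (real k * t)) {..Suc n}"
  obtain c q where p: "p = pCons c q" by (cases p)
  with Suc.prems have "degree q \<le> n" by (auto split: if_splits)
  from Suc.IH[OF this] obtain a
    where a: "\<And>t. poly q (cos t) = (\<Sum>k\<le>n. a k * cos (real k * t))"
    unfolding in_span_def by blast
  have base: "?S (\<lambda>t. cos (real k * t))" if "k \<le> Suc n" for k
    using in_span_base[of "{..Suc n}" k "\<lambda>k t. cos (real k * t)"] that by simp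
  have step: "?S (\<lambda>t. cos t * cos (real k * t))" if "k \<le> n" for k
  proof (cases k)
    case 0
    then show ?thesis using base[of 1] by simp
  next
    case (Suc j)
    have shift: "real (Suc k) * t = real k * t + t" "real j * t = real k * t - t" for t
      by (simp_all add: Suc algebra_simps)
    show ?thesis
    proof (rule in_span_cong[OF in_span_cmult[OF in_span_add[OF base base]]])
      fix t
      show "1/2 * (cos (real (Suc k) * t) + cos (real j * t)) = cos t * cos (real k * t)"
        using shift[of t] by (simp add: cos_add cos_diff)
    qed (use Suc that in auto)
  qed
  have "?S (\<lambda>t. c * cos (real 0 * t) + (\<Sum>k\<le>n. a k * (cos t * cos (real k * t))))"
    by (intro in_span_add in_span_cmult in_span_sum step base) auto
  then show ?case
    by (rule in_span_cong) (simp add: p a sum_distrib_left mult_ac)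
qed

text \<open>Expand the polynomial in cosines up to frequency \<open>n - 1\<close> and use that
  \<open>sin t * cos (k t)\<close> is half the difference of the sines of frequencies
  \<open>k + 1\<close> and \<open>k - 1\<close>.\<close>

lemma sin_poly_cos_in_span:
  "degree p < n \<Longrightarrow> in_span (\<lambda>k t. sin (real k * t)) {1..n} (\<lambda>t. sin t * poly p (cos t))"
proof -
  assume n: "degree p < n"
  then obtain a where a: "\<And>t. poly p (cos t) = (\<Sum>k\<le>n-1. a k * cos (real k * t))"
    using poly_cos_in_span[of p "n - 1"] unfolding in_span_def by fastforce
  let ?S = "in_span (\<lambda>k t. sin (real k * t)) {1..n}"
  \<comment> \<open>Frequency 0 lies outside the index set but does occur, as \<open>k - 1\<close>
    for \<open>k = 1\<close>; its sine is the zero function.\<close>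
  have base: "?S (\<lambda>t. sin (real k * t))" if "k \<le> n" for k
  proof (cases "k = 0")
    case True
    then show ?thesis by (auto simp: in_span_def intro!: exI[of _ "\<lambda>_. 0"])
  next
    case False
    then show ?thesis
      using in_span_base[of "{1..n}" k "\<lambda>k t. sin (real k * t)"] that by simp
  qed
  have step: "?S (\<lambda>t. sin t * cos (real k * t))" if "k \<le> n - 1" for k
  proof (cases k)
    case 0
    then show ?thesis using base[of 1] n by simp
  next
    case (Suc j)
    have shift: "real (Suc k) * t = real k * t + t" "real j * t = real k * t - t" for t
      by (simp_all add: Suc algebra_simps)
    show ?thesis
    proof (rule in_span_cong[OF in_span_add[OF in_span_cmult in_span_cmult, OF base base]])
      fix t
      have "1/2 * sin (real (Suc k) * t) + (-1/2) * sin (real j * t)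
          = 1/2 * (sin (real (Suc k) * t) - sin (real j * t))" by (simp add: field_simps)
      also have "\<dots> = sin t * cos (real k * t)"
        using shift[of t] by (simp add: sin_add sin_diff)
      finally show "1/2 * sin (real (Suc k) * t) + (-1/2) * sin (real j * t)
          = sin t * cos (real k * t)" .
    qed (use Suc that n in auto)
  qed
  have "?S (\<lambda>t. \<Sum>k\<le>n-1. a k * (sin t * cos (real k * t)))"
    by (intro in_span_cmult in_span_sum step) auto
  then show ?thesis
    by (rule in_span_cong) (simp add: a sum_distrib_left mult_ac)
qed

text \<open>Separates the even from the odd part, so that facts about \<open>in_span\<close> carry
  over to trigonometric polynomials.\<close>

lemma trig_poly_iff:
  "trig_poly n T \<longleftrightarrow> (\<exists>f g. in_span (\<lambda>k t. cos (real k * t)) {..n} f \<and>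
      in_span (\<lambda>k t. sin (real k * t)) {1..n} g \<and> T = (\<lambda>t. f t + g t))" (is "?l = ?r")
proof
  have split0: "(\<Sum>k\<le>n. a k * cos (real k * t)) = a 0 + (\<Sum>k=1..n. a k * cos (real k * t))"
    for a t by (simp add: atMost_atLeast0 sum.atLeast_Suc_atMost)
  {
    assume ?l
    then obtain a b where "\<And>t. T t = a 0 + (\<Sum>k=1..n. a k * cos (real k * t) + b k * sin (real k * t))"
      unfolding trig_poly_def by blast
    then have "T = (\<lambda>t. (\<Sum>k\<le>n. a k * cos (real k * t)) + (\<Sum>k=1..n. b k * sin (real k * t)))"
      by (simp add: fun_eq_iff split0 sum.distrib)
    then show ?r unfolding in_span_def
      by (intro exI[of _ "\<lambda>t. \<Sum>k\<le>n. a k * cos (real k * t)"]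
          exI[of _ "\<lambda>t. \<Sum>k=1..n. b k * sin (real k * t)"]) auto
  next
    assume ?r
    then obtain f g a b
      where "\<forall>t. f t = (\<Sum>k\<le>n. a k * cos (real k * t))"
        "\<forall>t. g t = (\<Sum>k=1..n. b k * sin (real k * t))" "T = (\<lambda>t. f t + g t)"
      unfolding in_span_def by blast
    then have "\<And>t. T t = a 0 + (\<Sum>k=1..n. a k * cos (real k * t) + b k * sin (real k * t))"
      by (simp add: split0 sum.distrib)
    then show ?l unfolding trig_poly_def by blast
  }
qed

section \<open>Orthogonality relations and uniform bounds from mean squares\<close>

lemma has_integral_cos_multiple:
  "((\<lambda>t. cos (of_int m * t)) has_integral (if m = 0 then pi else 0)) {0..pi}"
proof (cases "m = 0")
  case True
  then show ?thesis using has_integral_const_real[of "1::real" 0 pi] by simp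
next
  case False
  have "((\<lambda>t. cos (of_int m * t)) has_integral
      (sin (of_int m * pi) / of_int m - sin (of_int m * 0) / of_int m)) {0..pi}"
    using False
    by (intro fundamental_theorem_of_calculus)
       (auto intro!: derivative_eq_intros simp flip: has_real_derivative_iff_has_vector_derivative)
  then show ?thesis using False by (simp add: sin_npi_int mult.commute)
qed

text \<open>Parseval turns the integral into a sum of \<open>(a k)^2 * G k\<close>, which is at
  least \<open>m\<close> times the sum of the squared coefficients. Cauchy-Schwarz bounds
  \<open>(f t)^2\<close> by that sum times the sum of \<open>(B k t)^2\<close>, and the latter is at
  most \<open>card A\<close>.\<close>

lemma nikolskii_orthogonal:
  assumes "finite A"
    and orth: "\<And>j k. j \<in> A \<Longrightarrow> k \<in> A \<Longrightarrow> ((\<lambda>t. B j t * B k t) has_integral (if j = k then G k else 0)) I"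
    and G: "\<And>k. k \<in> A \<Longrightarrow> m \<le> G k" and m: "0 < m"
    and B: "\<And>k t. k \<in> A \<Longrightarrow> \<bar>B k t\<bar> \<le> 1"
    and f: "in_span B A f"
  shows "(f t)\<^sup>2 \<le> card A / m * integral I (\<lambda>t. (f t)\<^sup>2)"
proof -
  obtain a where a: "\<And>t. f t = (\<Sum>k\<in>A. a k * B k t)" using f unfolding in_span_def by blast
  have "((\<lambda>t. \<Sum>j\<in>A. \<Sum>k\<in>A. a j * a k * (B j t * B k t)) has_integral
      (\<Sum>j\<in>A. \<Sum>k\<in>A. a j * a k * (if j = k then G k else 0))) I"
    by (intro has_integral_sum assms(1) has_integral_mult_right orth)
  moreover have "(\<lambda>t. \<Sum>j\<in>A. \<Sum>k\<in>A. a j * a k * (B j t * B k t)) = (\<lambda>t. (f t)\<^sup>2)"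
    by (simp add: a power2_eq_square sum_product mult_ac)
  moreover have "(\<Sum>j\<in>A. \<Sum>k\<in>A. a j * a k * (if j = k then G k else 0)) = (\<Sum>k\<in>A. (a k)\<^sup>2 * G k)"
    using assms(1) by (simp add: if_distrib power2_eq_square cong: if_cong)
  ultimately have int: "integral I (\<lambda>t. (f t)\<^sup>2) = (\<Sum>k\<in>A. (a k)\<^sup>2 * G k)"
    by (metis integral_unique)
  have "(f t)\<^sup>2 \<le> (\<Sum>k\<in>A. (a k)\<^sup>2) * (\<Sum>k\<in>A. (B k t)\<^sup>2)"
    unfolding a by (rule Cauchy_Schwarz_ineq_sum)
  also have "\<dots> \<le> (\<Sum>k\<in>A. (a k)\<^sup>2) * (\<Sum>k\<in>A. 1)"
    using B by (intro mult_left_mono sum_mono sum_nonneg) (auto simp: abs_square_le_1)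
  also have "(\<Sum>k\<in>A. (a k)\<^sup>2) \<le> (\<Sum>k\<in>A. (a k)\<^sup>2 * G k / m)"
    using G m by (intro sum_mono) (simp add: pos_le_divide_eq mult_left_mono)
  finally show ?thesis
    unfolding int by (simp add: sum_divide_distrib[symmetric] mult_right_mono mult.commute)
qed

lemma nikolskii_poly_cos:
  assumes "degree p < n"
  shows "(poly p (cos t))\<^sup>2 \<le> 2 * n / pi * integral {0..pi} (\<lambda>t. (poly p (cos t))\<^sup>2)"
proof -
  have "(poly p (cos t))\<^sup>2 \<le> card {..n-1} / (pi/2) * integral {0..pi} (\<lambda>t. (poly p (cos t))\<^sup>2)"
  \<comment> \<open>The constant function has squared norm \<open>pi\<close>, the other cosines
    \<open>pi/2\<close>; the smaller value serves as \<open>m\<close>.\<close>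
  proof (rule nikolskii_orthogonal[where G = "\<lambda>k. if k = 0 then pi else pi/2"])
    fix j k :: nat
    have "((\<lambda>t. 1/2 * (cos (of_int (int j - int k) * t) + cos (of_int (int j + int k) * t)))
       has_integral 1/2 * ((if int j - int k = 0 then pi else 0) + (if int j + int k = 0 then pi else 0))) {0..pi}"
      by (intro has_integral_mult_right has_integral_add has_integral_cos_multiple)
    moreover have "1/2 * (cos (of_int (int j - int k) * t) + cos (of_int (int j + int k) * t))
        = cos (real j * t) * cos (real k * t)" for t
      by (simp add: cos_times_cos left_diff_distrib distrib_right)
    ultimately show "((\<lambda>t. cos (real j * t) * cos (real k * t)) has_integral
        (if j = k then if k = 0 then pi else pi/2 else 0)) {0..pi}"
      by (simp only:) (auto elim!: has_integral_eq_rhs)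
  qed (use assms poly_cos_in_span in auto)
  then show ?thesis using assms by (simp add: mult_ac)
qed

lemma nikolskii_sin_poly_cos:
  assumes "degree p < n"
  shows "(sin t * poly p (cos t))\<^sup>2 \<le>
    2 * n / pi * integral {0..pi} (\<lambda>t. (sin t * poly p (cos t))\<^sup>2)"
proof -
  have "(sin t * poly p (cos t))\<^sup>2 \<le>
      card {1..n} / (pi/2) * integral {0..pi} (\<lambda>t. (sin t * poly p (cos t))\<^sup>2)"
  proof (rule nikolskii_orthogonal[where G = "\<lambda>_. pi/2"])
    fix j k :: nat assume jk: "j \<in> {1..n}" "k \<in> {1..n}"
    have "((\<lambda>t. 1/2 * (cos (of_int (int j - int k) * t) - cos (of_int (int j + int k) * t)))
       has_integral 1/2 * ((if int j - int k = 0 then pi else 0) - (if int j + int k = 0 then pi else 0))) {0..pi}"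
      by (intro has_integral_mult_right has_integral_diff has_integral_cos_multiple)
    moreover have "1/2 * (cos (of_int (int j - int k) * t) - cos (of_int (int j + int k) * t))
        = sin (real j * t) * sin (real k * t)" for t
      by (simp add: sin_times_sin left_diff_distrib distrib_right)
    ultimately show "((\<lambda>t. sin (real j * t) * sin (real k * t)) has_integral
        (if j = k then pi/2 else 0)) {0..pi}"
      using jk by (simp only:) (auto elim!: has_integral_eq_rhs)
  qed (use assms sin_poly_cos_in_span in auto)
  then show ?thesis by (simp add: mult_ac)
qed

section \<open>Jackson's theorem\<close>

lemma trig_poly_cmult: "trig_poly n f \<Longrightarrow> trig_poly n (\<lambda>t. c * f t)"
  unfolding trig_poly_iff
proof (elim exE conjE)
  fix g h assume "in_span (\<lambda>k t. cos (real k * t)) {..n} g"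
    "in_span (\<lambda>k t. sin (real k * t)) {1..n} h" "f = (\<lambda>t. g t + h t)"
  then show "\<exists>g h. in_span (\<lambda>k t. cos (real k * t)) {..n} g \<and>
      in_span (\<lambda>k t. sin (real k * t)) {1..n} h \<and> (\<lambda>t. c * f t) = (\<lambda>t. g t + h t)"
    by (intro exI[of _ "\<lambda>t. c * g t"] exI[of _ "\<lambda>t. c * h t"] conjI in_span_cmult)
       (auto simp: distrib_left)
qed

lemma trig_poly_add:
  assumes "trig_poly n f" "trig_poly n g"
  shows "trig_poly n (\<lambda>t. f t + g t)"
proof -
  obtain f1 f2 g1 g2 where
    "in_span (\<lambda>k t. cos (real k * t)) {..n} f1" "in_span (\<lambda>k t. sin (real k * t)) {1..n} f2"
    "in_span (\<lambda>k t. cos (real k * t)) {..n} g1" "in_span (\<lambda>k t. sin (real k * t)) {1..n} g2"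
    and "f = (\<lambda>t. f1 t + f2 t)" "g = (\<lambda>t. g1 t + g2 t)"
    using assms unfolding trig_poly_iff by blast
  then show ?thesis
    unfolding trig_poly_iff
    by (intro exI[of _ "\<lambda>t. f1 t + g1 t"] exI[of _ "\<lambda>t. f2 t + g2 t"] conjI in_span_add) auto
qed

lemma trig_poly_zero: "trig_poly n (\<lambda>t. 0)"
  unfolding trig_poly_def by (rule exI[of _ "\<lambda>_. 0"])+ simp

lemma trig_poly_sum:
  "(\<And>i. i \<in> I \<Longrightarrow> trig_poly n (f i)) \<Longrightarrow> trig_poly n (\<lambda>t. \<Sum>i\<in>I. f i t)"
proof (induction I rule: infinite_finite_induct)
  case (insert x F)
  then show ?case using trig_poly_add[of n "f x" "\<lambda>t. \<Sum>i\<in>F. f i t"] by simp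
qed (auto simp: trig_poly_zero)

lemma trig_poly_cos_shift:
  assumes "\<bar>k\<bar> \<le> int n"
  shows "trig_poly n (\<lambda>t. cos (of_int k * (t - c)))"
proof -
  define m where "m = nat \<bar>k\<bar>"
  have m: "m \<le> n" using assms by (simp add: m_def)
  have "cos (of_int k * (t - c)) = cos (real m * (t - c))" for t
    by (cases "k \<ge> 0") (auto simp: m_def minus_mult_left[symmetric] simp del: minus_mult_left)
  then have eq: "cos (of_int k * (t - c)) =
      cos (real m * c) * cos (real m * t) + sin (real m * c) * sin (real m * t)" for t
    by (simp add: right_diff_distrib cos_diff)
  have "in_span (\<lambda>k t. cos (real k * t)) {..n} (\<lambda>t. cos (real m * t))"
    using in_span_base[of "{..n}" m "\<lambda>k t. cos (real k * t)"] m by simp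
  moreover have "in_span (\<lambda>k t. sin (real k * t)) {1..n} (\<lambda>t. sin (real m * t))"
  proof (cases "m = 0")
    case True
    then show ?thesis by (auto simp: in_span_def intro!: exI[of _ "\<lambda>_. 0"])
  next
    case False
    then show ?thesis
      using in_span_base[of "{1..n}" m "\<lambda>k t. sin (real k * t)"] m by simp
  qed
  ultimately show ?thesis
    unfolding trig_poly_iff eq
    by - (intro exI conjI, (rule in_span_cmult, assumption)+, rule refl)
qed

lemma trig_poly_mono:
  assumes "trig_poly m f" "m \<le> n" shows "trig_poly n f"
proof -
  obtain a b where f: "\<And>t. f t = a 0 + (\<Sum>k=1..m. a k * cos (real k * t) + b k * sin (real k * t))"
    using assms unfolding trig_poly_def by blast
  define c where "c a k = (if k \<le> m then a k else 0 :: real)" for a k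
  have "(\<Sum>k=1..m. a k * cos (real k * t) + b k * sin (real k * t)) =
      (\<Sum>k=1..n. c a k * cos (real k * t) + c b k * sin (real k * t))" for t
    using assms(2) by (intro sum.mono_neutral_cong_left) (auto simp: c_def)
  then have "f t = c a 0 + (\<Sum>k=1..n. c a k * cos (real k * t) + c b k * sin (real k * t))" for t
    by (simp add: f c_def)
  then show ?thesis unfolding trig_poly_def by blast
qed

text \<open>Real part of a geometric sum over powers of an \<open>N\<close>-th root of unity
  \<open>z\<close>. The bound on \<open>k\<close> enters through \<open>z \<noteq> 1\<close>:
  otherwise \<open>N\<close> would divide the nonzero \<open>k\<close>.\<close>

lemma sum_cos_equispaced:
  assumes "\<bar>k\<bar> < int N"
  shows "(\<Sum>j<N. cos (of_int k * (t - 2 * pi * real j / real N))) = (if k = 0 then real N else 0)"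
proof (cases "k = 0")
  case False
  define z where "z = cis (- (of_int k * 2 * pi / real N))"
  have N: "N > 0" using assms by simp
  have "z \<noteq> 1"
  proof
    assume "z = 1"
    then have "cos (of_int k * 2 * pi / real N) = 1" by (simp add: z_def complex_eq_iff)
    then obtain m :: int where "of_int k * 2 * pi / real N = of_int m * 2 * pi"
      unfolding cos_one_2pi_int by blast
    then have "of_int k = (of_int (m * int N) :: real)" using N by (simp add: field_simps)
    then have "k = m * int N" by linarith
    with False assms show False
      by (metis abs_mult abs_of_nat dvd_imp_le_int dvd_triv_right leD)
  qed
  moreover have "z ^ N = 1"
  proof -
    have "real N * - (of_int k * 2 * pi / real N) = 2 * pi * of_int (- k)" using N by simp
    then have "z ^ N = cis (2 * pi * of_int (- k))" by (simp only: z_def Complex.DeMoivre)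
    then show ?thesis by (simp add: cis_multiple_2pi del: of_int_minus)
  qed
  ultimately have "(\<Sum>j<N. z ^ j) = 0" by (simp add: geometric_sum)
  then have "(\<Sum>j<N. cis (of_int k * t) * z ^ j) = 0" by (simp flip: sum_distrib_left)
  moreover have "cis (of_int k * t) * z ^ j = cis (of_int k * (t - 2 * pi * real j / real N))" for j
    by (simp add: z_def Complex.DeMoivre cis_mult right_diff_distrib mult_ac)
  ultimately have "Re (\<Sum>j<N. cis (of_int k * (t - 2 * pi * real j / real N))) = 0" by simp
  with False show ?thesis by simp
qed simp

text \<open>
  The kernel is the square modulus of \<open>\<Sum> a\<^sub>k e\<^sup>i\<^sup>k\<^sup>t\<close> with the Fejer--Korovkin coefficients
  \<open>a\<^sub>k = sin (k \<pi> / N)\<close>; the relation \<open>a\<^sub>k\<^sub>+\<^sub>1 + a\<^sub>k\<^sub>-\<^sub>1 = 2 cos (\<pi> / N) a\<^sub>k\<close> gives its first moment.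
\<close>

lemma korovkin_kernel:
  assumes N: "2 \<le> N"
  obtains K :: "real \<Rightarrow> real" where "\<And>u. 0 \<le> K u"
    "\<And>s. trig_poly (N - 1) (\<lambda>t. K (t - s))"
    "\<And>t. (\<Sum>j<N. K (t - 2 * pi * real j / real N)) = 1"
    "\<And>t. (\<Sum>j<N. K (t - 2 * pi * real j / real N) * cos (t - 2 * pi * real j / real N)) = cos (pi / real N)"
proof -
  define a where "a k = sin (of_int k * pi / real N)" for k :: int
  define A where "A = {1..<int N}"
  define K0 where "K0 u = (\<Sum>k\<in>A. \<Sum>l\<in>A. a k * a l * cos (of_int (k - l) * u))" for u :: real
  define S where "S = (\<Sum>k\<in>A. (a k)\<^sup>2)"
  have fin: "finite A" by (simp add: A_def)
  have "a 1 > 0"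
    using N by (auto simp: a_def field_simps intro!: sin_gt_zero)
  moreover have "1 \<in> A" using N by (simp add: A_def)
  ultimately have S: "S > 0" unfolding S_def using fin by (intro sum_pos2[of _ 1]) auto
  have K0_sq: "K0 u = (\<Sum>k\<in>A. a k * cos (of_int k * u))\<^sup>2 + (\<Sum>k\<in>A. a k * sin (of_int k * u))\<^sup>2" for u
    unfolding K0_def power2_eq_square sum_product sum.distrib[symmetric]
    by (intro sum.cong refl) (simp add: left_diff_distrib cos_diff algebra_simps)
  have trig: "trig_poly (N - 1) (\<lambda>t. K0 (t - s))" for s
    unfolding K0_def
    by (intro trig_poly_sum trig_poly_cmult trig_poly_cos_shift) (auto simp: A_def)
  have mean: "(\<Sum>j<N. K0 (t - 2 * pi * real j / real N)) = N * S" for t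
  proof -
    have "(\<Sum>j<N. K0 (t - 2 * pi * real j / real N)) =
        (\<Sum>k\<in>A. \<Sum>l\<in>A. a k * a l * (\<Sum>j<N. cos (of_int (k - l) * (t - 2 * pi * real j / real N))))"
      unfolding K0_def sum_distrib_left
      by (subst sum.swap, intro sum.cong refl, subst sum.swap, rule refl)
    also have "\<dots> = (\<Sum>k\<in>A. \<Sum>l\<in>A. a k * a l * (if k = l then real N else 0))"
      by (intro sum.cong refl, subst sum_cos_equispaced) (auto simp: A_def)
    also have "\<dots> = N * S"
      using fin by (simp add: S_def sum_distrib_left power2_eq_square if_distrib mult_ac cong: if_cong)
    finally show ?thesis .
  qed
  have mean1: "(\<Sum>j<N. K0 (t - 2 * pi * real j / real N) * cos (t - 2 * pi * real j / real N))
      = N * S * cos (pi / real N)" for t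
  proof -
    have a0: "a 0 = 0" "a (int N) = 0" using N by (auto simp: a_def)
    have rec: "a (k - 1) + a (k + 1) = 2 * cos (pi / real N) * a k" for k
    proof -
      have "of_int (k - 1) * pi / real N = of_int k * pi / real N - pi / real N"
        "of_int (k + 1) * pi / real N = of_int k * pi / real N + pi / real N"
        by (simp_all add: algebra_simps diff_divide_distrib add_divide_distrib)
      then show ?thesis by (simp add: a_def sin_add sin_diff)
    qed
    have prod: "cos (of_int m * u) * cos u = (cos (of_int (m + 1) * u) + cos (of_int (m - 1) * u)) / 2"
      for m :: int and u :: real
      by (simp add: distrib_right left_diff_distrib cos_add cos_diff)
    have "(\<Sum>j<N. K0 (t - 2 * pi * real j / real N) * cos (t - 2 * pi * real j / real N)) =
        (\<Sum>k\<in>A. \<Sum>l\<in>A. a k * a l * (\<Sum>j<N. cos (of_int (k - l) * (t - 2 * pi * real j / real N))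
          * cos (t - 2 * pi * real j / real N)))"
      unfolding K0_def sum_distrib_left sum_distrib_right mult.assoc
      by (subst sum.swap, intro sum.cong refl, subst sum.swap, rule refl)
    \<comment> \<open>The differences \<open>k - l\<close> are at most \<open>N - 2\<close> in
      absolute value. Multiplication by the cosine shifts them by one, so they stay below
      \<open>N\<close> and \<open>sum_cos_equispaced\<close> still applies; only
      \<open>l = k + 1\<close> and \<open>l = k - 1\<close> survive.\<close>
    also have "\<dots> = (\<Sum>k\<in>A. \<Sum>l\<in>A. a k * a l *
        (((if k - l + 1 = 0 then real N else 0) + (if k - l - 1 = 0 then real N else 0)) / 2))"
      unfolding prod sum_divide_distrib[symmetric] sum.distrib
      by (intro sum.cong refl, subst (1 2) sum_cos_equispaced) (auto simp: A_def)
    also have "\<dots> = (\<Sum>k\<in>A. N / 2 * a k * ((\<Sum>l\<in>A. if l = k + 1 then a l else 0)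
        + (\<Sum>l\<in>A. if l = k - 1 then a l else 0)))"
      unfolding sum_distrib_left sum.distrib[symmetric]
      by (intro sum.cong refl) auto
    \<comment> \<open>A neighbour of \<open>k\<close> outside \<open>A\<close> is \<open>0\<close>
      or \<open>N\<close>, where \<open>a\<close> vanishes, so the truncation to \<open>A\<close>
      loses nothing.\<close>
    also have "\<dots> = (\<Sum>k\<in>A. N / 2 * a k * (a (k + 1) + a (k - 1)))"
    proof (intro sum.cong refl, goal_cases)
      case (1 k)
      then have "k + 1 \<notin> A \<Longrightarrow> k + 1 = int N" "k - 1 \<notin> A \<Longrightarrow> k - 1 = 0" by (auto simp: A_def)
      then have "(\<Sum>l\<in>A. if l = k + 1 then a l else 0) = a (k + 1)"
        "(\<Sum>l\<in>A. if l = k - 1 then a l else 0) = a (k - 1)"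
        using fin a0 by auto
      then show ?case by simp
    qed
    also have "\<dots> = (\<Sum>k\<in>A. N / 2 * a k * (2 * cos (pi / real N) * a k))"
      by (simp add: rec[symmetric] add.commute)
    also have "\<dots> = N * S * cos (pi / real N)"
      by (simp add: S_def sum_distrib_left sum_distrib_right power2_eq_square mult_ac)
    finally show ?thesis .
  qed
  have NS: "N \<noteq> 0" "S \<noteq> 0" using N S by auto
  show thesis
  proof
    show "0 \<le> K0 u / (N * S)" for u using S by (simp add: K0_sq)
    show "trig_poly (N - 1) (\<lambda>t. K0 (t - s) / (N * S))" for s
      using trig_poly_cmult[OF trig, of "1 / (N * S)"] by simp
    show "(\<Sum>j<N. K0 (t - 2 * pi * real j / real N) / (N * S)) = 1" for t
      using NS by (simp add: mean flip: sum_divide_distrib)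
    show "(\<Sum>j<N. K0 (t - 2 * pi * real j / real N) / (N * S) * cos (t - 2 * pi * real j / real N))
        = cos (pi / real N)" for t
      using NS by (simp add: mean1 flip: sum_divide_distrib)
  qed
qed

text \<open>With \<open>x = \<bar>r\<bar> / 2\<close>, which is at most \<open>pi/2 < 8/5\<close>,
  the bound \<open>sin x \<ge> x - x^3 / 6\<close> and \<open>x^2 \<le> 3\<close> give
  \<open>sin x \<ge> x / 2\<close>. Squaring and \<open>1 - cos r = 2 * (sin x)^2\<close> yield the
  constant 8.\<close>

lemma square_le_one_minus_cos:
  fixes r :: real
  assumes "\<bar>r\<bar> \<le> pi"
  shows "r\<^sup>2 \<le> 8 * (1 - cos r)"
proof -
  define x where "x = \<bar>r\<bar> / 2"
  have x: "0 \<le> x" "x \<le> 8/5" using assms pi_approx by (auto simp: x_def)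
  have "\<bar>sin x - x\<bar> \<le> x ^ 3 / 6"
    using Maclaurin_sin_bound[of x 3] x
    by (simp add: eval_nat_numeral sin_coeff_def fact_numeral)
  moreover have "x ^ 3 \<le> 3 * x"
  proof -
    have "x * x \<le> 8/5 * (8/5)" using x by (intro mult_mono) auto
    then have "(x * x) * x \<le> 3 * x" using x by (intro mult_right_mono) auto
    then show ?thesis by (simp add: eval_nat_numeral)
  qed
  ultimately have "x / 2 \<le> sin x" by linarith
  then have "(x / 2)\<^sup>2 \<le> (sin x)\<^sup>2" using x by (intro power_mono) auto
  moreover have "cos r = 1 - 2 * (sin x)\<^sup>2"
    using cos_double_sin[of x] by (simp add: x_def)
  ultimately show ?thesis by (simp add: x_def power_divide)
qed

lemma one_minus_cos_le: "1 - cos (x :: real) \<le> x\<^sup>2 / 2"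
proof -
  have "(sin (x / 2))\<^sup>2 \<le> (x / 2)\<^sup>2"
    using abs_sin_x_le_abs_x[of "x / 2"] unfolding abs_le_square_iff .
  then show ?thesis using cos_double_sin[of "x / 2"] by (simp add: power_divide)
qed

text \<open>The supremum is an upper bound because a continuous \<open>f\<close> is bounded on the
  compact interval.\<close>

lemma modulus_of_continuity_ge:
  assumes "continuous_on {0..2*pi} f" "s \<in> {0..2*pi}" "t \<in> {0..2*pi}" "\<bar>s - t\<bar> < \<delta>"
  shows "\<bar>f s - f t\<bar> \<le> modulus_of_continuity f \<delta>"
proof -
  obtain M where M: "\<And>x. x \<in> {0..2*pi} \<Longrightarrow> \<bar>f x\<bar> \<le> M"
    using compact_imp_bounded[OF compact_continuous_image[OF assms(1) compact_Icc]]
    unfolding bounded_iff by fastforce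
  have "bdd_above {\<bar>f s - f t\<bar> | s t. s \<in> {0..2*pi} \<and> t \<in> {0..2*pi} \<and> \<bar>s - t\<bar> < \<delta>}"
  proof (rule bdd_aboveI[of _ "2 * M"], elim CollectE exE conjE, goal_cases)
    case (1 y s t)
    then show ?case using M[of s] M[of t] by linarith
  qed
  then show ?thesis
    unfolding modulus_of_continuity_def using assms by (intro cSup_upper) auto
qed

section \<open>Periodic extension and its increments\<close>

context
  fixes f :: "real \<Rightarrow> real"
  assumes f: "continuous_on {0..2*pi} f" "f 0 = f (2*pi)"
begin

text \<open>The floor moves \<open>t\<close> into the half-open period from \<open>0\<close> to
  \<open>2 * pi\<close>; since \<open>f 0 = f (2*pi)\<close>, the result agrees with
  \<open>f\<close> at the right endpoint too.\<close>

definition periodic_extension :: "real \<Rightarrow> real" where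
  "periodic_extension t = f (t - 2 * pi * of_int \<lfloor>t / (2*pi)\<rfloor>)"

lemma periodic_extension_periodic: "periodic_extension (t + 2 * pi * of_int m) = periodic_extension t"
proof -
  have "(t + 2 * pi * of_int m) / (2*pi) = t / (2*pi) + of_int m" by (simp add: field_simps)
  then show ?thesis by (simp add: periodic_extension_def algebra_simps)
qed

lemma periodic_extension_eq: assumes "t \<in> {0..2*pi}" shows "periodic_extension t = f t"
proof (cases "t = 2 * pi")
  case False
  then have "\<lfloor>t / (2*pi)\<rfloor> = 0" using assms by (auto simp: floor_eq_iff field_simps)
  then show ?thesis by (simp add: periodic_extension_def)
qed (simp add: periodic_extension_def f)

text \<open>After a shift by whole periods the smaller point lies in the base period and the other
  is less than \<open>\<delta> \<le> 2 * pi\<close> beyond it, so at most one seam is crossed. The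
  path through the seam has two legs, each shorter than \<open>\<delta>\<close>; hence the factor
  2.\<close>

lemma periodic_extension_local:
  assumes d: "\<delta> \<le> 2 * pi" and st: "\<bar>s - t\<bar> < \<delta>"
  shows "\<bar>periodic_extension s - periodic_extension t\<bar> \<le> 2 * modulus_of_continuity f \<delta>"
  using st
proof (induction s t rule: linorder_wlog)
  case (le s t)
  let ?\<omega> = "modulus_of_continuity f \<delta>"
  have \<omega>0: "0 \<le> ?\<omega>" using modulus_of_continuity_ge[OF f(1), of 0 0 \<delta>] le(2) by simp
  define m where "m = \<lfloor>s / (2*pi)\<rfloor>"
  define s' t' where "s' = s - 2 * pi * of_int m" and "t' = t - 2 * pi * of_int m"
  have "of_int m \<le> s / (2*pi)" "s / (2*pi) < of_int m + 1" by (simp_all add: m_def)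
  then have s': "0 \<le> s'" "s' < 2 * pi" by (simp_all add: s'_def field_simps)
  have st': "s' \<le> t'" "t' - s' < \<delta>" using le by (simp_all add: s'_def t'_def)
  have es: "periodic_extension s = f s'" and et: "periodic_extension t = periodic_extension t'"
    using periodic_extension_periodic[of s "-m"] periodic_extension_eq[of s'] periodic_extension_periodic[of t "-m"] s'
    by (simp_all add: s'_def t'_def)
  show ?case
  proof (cases "t' \<le> 2 * pi")
    case True
    then have "\<bar>f s' - f t'\<bar> \<le> ?\<omega>"
      using s' st' by (intro modulus_of_continuity_ge f) auto
    then show ?thesis using periodic_extension_eq[of t'] True s' st' \<omega>0 by (simp add: es et)
  next
    case False
    define r where "r = t' - 2 * pi"
    have r: "0 < r" "r < \<delta>" "r \<le> 2 * pi" using False st' s' d by (auto simp: r_def)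
    have "periodic_extension t' = f r"
      using periodic_extension_periodic[of t' "-1"] periodic_extension_eq[of r] r by (simp add: r_def)
    moreover have "\<bar>f s' - f (2*pi)\<bar> \<le> ?\<omega>"
      using s' st' False by (intro modulus_of_continuity_ge f) auto
    moreover have "\<bar>f 0 - f r\<bar> \<le> ?\<omega>"
      using r by (intro modulus_of_continuity_ge f) auto
    ultimately show ?thesis using f(2) by (simp add: es et)
  qed
qed (simp add: abs_minus_commute)

lemma periodic_extension_chain:
  assumes d: "\<delta> \<le> 2 * pi"
  shows "\<bar>s - t\<bar> < real (Suc k) * \<delta> \<Longrightarrow>
    \<bar>periodic_extension s - periodic_extension t\<bar> \<le> real (Suc k) * (2 * modulus_of_continuity f \<delta>)"
proof (induction k arbitrary: s)
  case 0
  then show ?case using periodic_extension_local[OF d, of s t] by simp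
next
  case (Suc k)
  \<comment> \<open>\<open>u\<close> cuts off the first of \<open>k + 2\<close> equal pieces,
    leaving \<open>k + 1\<close> of them for the induction hypothesis.\<close>
  define u where "u = s + (t - s) / real (Suc (Suc k))"
  have "s - u = (s - t) / real (Suc (Suc k))" by (simp add: u_def field_simps)
  then have "\<bar>s - u\<bar> = \<bar>s - t\<bar> / real (Suc (Suc k))" by (simp add: abs_divide)
  then have "\<bar>s - u\<bar> < \<delta>" using Suc.prems by (simp only: divide_less_eq) (simp add: mult.commute)
  then have "\<bar>periodic_extension s - periodic_extension u\<bar> \<le> 2 * modulus_of_continuity f \<delta>"
    by (rule periodic_extension_local[OF d])
  moreover have "u - t = (s - t) * (real (Suc k) / real (Suc (Suc k)))"
    by (simp add: u_def field_simps)
  then have "\<bar>u - t\<bar> = \<bar>s - t\<bar> * (real (Suc k) / real (Suc (Suc k)))"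
    by (simp add: abs_mult)
  then have "\<bar>u - t\<bar> < real (Suc k) * \<delta>"
    using mult_strict_right_mono[OF Suc.prems, of "real (Suc k) / real (Suc (Suc k))"]
    by (simp add: mult.commute)
  from Suc.IH[OF this]
  have "\<bar>periodic_extension u - periodic_extension t\<bar> \<le> real (Suc k) * (2 * modulus_of_continuity f \<delta>)" .
  ultimately show ?case by (simp add: algebra_simps)
qed

text \<open>The bound is phrased with \<open>1 - cos (s - t)\<close> because the kernel controls
  exactly the sums against 1 and the cosine. Reduce \<open>s - t\<close> modulo
  \<open>2 * pi\<close> to some \<open>r\<close> with \<open>\<bar>r\<bar> \<le> pi\<close>, chain
  over \<open>k + 1\<close> steps with \<open>k\<close> the floor of
  \<open>\<bar>r\<bar> / \<delta>\<close>, and bound the number of steps by a quadratic in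
  \<open>\<bar>r\<bar> / \<delta>\<close>.\<close>

lemma periodic_extension_global:
  assumes d: "\<delta> \<le> 2 * pi" "0 < \<delta>"
  shows "\<bar>periodic_extension s - periodic_extension t\<bar> \<le>
    (2 + 8 * (1 - cos (s - t)) / \<delta>\<^sup>2) * (2 * modulus_of_continuity f \<delta>)"
proof -
  have \<omega>0: "0 \<le> modulus_of_continuity f \<delta>"
    using modulus_of_continuity_ge[OF f(1), of 0 0 \<delta>] d by simp
  define m where "m = \<lfloor>(s - t + pi) / (2*pi)\<rfloor>"
  define r where "r = s - t - 2 * pi * of_int m"
  have "of_int m \<le> (s - t + pi) / (2*pi)" "(s - t + pi) / (2*pi) < of_int m + 1"
    by (simp_all add: m_def)
  then have r: "\<bar>r\<bar> \<le> pi" by (simp add: r_def field_simps abs_le_iff)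
  have es: "periodic_extension s = periodic_extension (t + r)"
    using periodic_extension_periodic[of s "-m"] by (simp add: r_def)
  have cr: "cos (s - t) = cos r"
    using cos_int_2pin[of m] sin_int_2pin[of m] by (simp add: r_def cos_diff[of "s - t"])
  define k where "k = nat \<lfloor>\<bar>r\<bar> / \<delta>\<rfloor>"
  have k: "real k \<le> \<bar>r\<bar> / \<delta>" "\<bar>r\<bar> / \<delta> < real (Suc k)"
    using d by (simp_all add: k_def) linarith
  have "\<bar>periodic_extension (t + r) - periodic_extension t\<bar> \<le> real (Suc k) * (2 * modulus_of_continuity f \<delta>)"
    using k d by (intro periodic_extension_chain) (auto simp: field_simps)
  also have "\<dots> \<le> (2 + 8 * (1 - cos r) / \<delta>\<^sup>2) * (2 * modulus_of_continuity f \<delta>)"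
  proof (intro mult_right_mono)
    \<comment> \<open>For every real \<open>y\<close>, \<open>y \<le> 1 + y^2\<close>, since
      \<open>(y - 1/2)^2 \<ge> 0\<close>.\<close>
    have "real k \<le> 1 + (\<bar>r\<bar> / \<delta>)\<^sup>2"
      using k(1) zero_le_power2[of "\<bar>r\<bar> / \<delta> - 1/2"] by (simp add: power2_eq_square algebra_simps)
    also have "(\<bar>r\<bar> / \<delta>)\<^sup>2 \<le> 8 * (1 - cos r) / \<delta>\<^sup>2"
      using square_le_one_minus_cos[OF r] by (simp add: power_divide divide_right_mono)
    finally show "real (Suc k) \<le> 2 + 8 * (1 - cos r) / \<delta>\<^sup>2" by simp
  qed (use \<omega>0 in simp)
  finally show ?thesis by (simp add: es cr)
qed

text \<open>\<open>T\<close> is the discrete convolution of the samples at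
  \<open>2 * pi * j / N\<close> with the kernel. As the kernel values are nonnegative with sum 1,
  \<open>T t - f t\<close> is a weighted mean of increments, and the global increment bound with
  \<open>\<delta> = 1/N\<close> reduces its size to the two known kernel sums.\<close>

lemma jackson_trigonometric:
  assumes "1 \<le> N"
  obtains T where "trig_poly (N - 1) T"
    "\<And>t. t \<in> {0..2*pi} \<Longrightarrow> \<bar>T t - f t\<bar> \<le> 132 * modulus_of_continuity f (1 / real N)"
proof (cases "N = 1")
  \<comment> \<open>The kernel needs \<open>N \<ge> 2\<close>. Here a constant suffices: the factor
    of the global bound is at most 18, relaxed to 66 to match the other case.\<close>
  case True
  have d: "1 \<le> 2 * pi" "0 < (1::real)" using pi_gt3 by linarith+
  show thesis
  proof
    show "trig_poly (N - 1) (\<lambda>_. f 0)"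
      using True by (simp add: trig_poly_def exI[of _ "\<lambda>_. f 0"])
    fix t assume t: "t \<in> {0..2*pi}"
    have "0 \<le> modulus_of_continuity f 1"
      using modulus_of_continuity_ge[OF f(1), of 0 0 1] by simp
    moreover have "2 + 8 * (1 - cos (0 - t)) \<le> 66" by (simp, use cos_ge_minus_one[of t] in linarith)
    ultimately have "(2 + 8 * (1 - cos (0 - t)) / 1\<^sup>2) * (2 * modulus_of_continuity f 1)
        \<le> 66 * (2 * modulus_of_continuity f 1)"
      by (intro mult_right_mono) auto
    with periodic_extension_global[OF d, of 0 t]
    have "\<bar>periodic_extension 0 - periodic_extension t\<bar> \<le> 66 * (2 * modulus_of_continuity f 1)"
      by (rule order_trans)
    then show "\<bar>f 0 - f t\<bar> \<le> 132 * modulus_of_continuity f (1 / real N)"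
      using t True by (simp add: periodic_extension_eq)
  qed
next
  case False
  with assms have N: "2 \<le> N" by simp
  obtain K :: "real \<Rightarrow> real" where K: "\<And>u. 0 \<le> K u"
    "\<And>s. trig_poly (N - 1) (\<lambda>t. K (t - s))"
    "\<And>t. (\<Sum>j<N. K (t - 2 * pi * real j / real N)) = 1"
    "\<And>t. (\<Sum>j<N. K (t - 2 * pi * real j / real N) * cos (t - 2 * pi * real j / real N)) = cos (pi / real N)"
    using korovkin_kernel[OF N] by blast
  let ?\<omega> = "modulus_of_continuity f (1 / real N)"
  define \<tau> where "\<tau> j = 2 * pi * real j / real N" for j
  define T where "T t = (\<Sum>j<N. periodic_extension (\<tau> j) * K (t - \<tau> j))" for t
  have d: "1 / real N \<le> 2 * pi" "0 < 1 / real N"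
  proof -
    have "1 / real N \<le> 1" using N by simp
    then show "1 / real N \<le> 2 * pi" using pi_gt3 by linarith
  qed (use N in simp)
  have \<omega>0: "0 \<le> ?\<omega>" using modulus_of_continuity_ge[OF f(1), of 0 0 "1 / real N"] d by simp
  show thesis
  proof
    show "trig_poly (N - 1) T"
      unfolding T_def by (intro trig_poly_sum trig_poly_cmult K)
    fix t assume t: "t \<in> {0..2*pi}"
    have "T t - f t = T t - periodic_extension t * (\<Sum>j<N. K (t - \<tau> j))"
      using K(3) periodic_extension_eq[OF t] by (simp add: \<tau>_def)
    also have "\<dots> = (\<Sum>j<N. K (t - \<tau> j) * (periodic_extension (\<tau> j) - periodic_extension t))"
      by (simp add: T_def sum_distrib_left sum_subtractf algebra_simps)
    finally have "\<bar>T t - f t\<bar> \<le> (\<Sum>j<N. \<bar>K (t - \<tau> j) * (periodic_extension (\<tau> j) - periodic_extension t)\<bar>)"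
      by (simp only: sum_abs)
    also have "\<dots> \<le> (\<Sum>j<N. K (t - \<tau> j) *
        ((2 + 8 * (1 - cos (t - \<tau> j)) / (1 / real N)\<^sup>2) * (2 * ?\<omega>)))"
    proof (intro sum_mono)
      fix j
      have "\<bar>periodic_extension (\<tau> j) - periodic_extension t\<bar> \<le>
          (2 + 8 * (1 - cos (t - \<tau> j)) / (1 / real N)\<^sup>2) * (2 * ?\<omega>)"
        using periodic_extension_global[OF d, of t "\<tau> j"] by (simp only: abs_minus_commute)
      then show "\<bar>K (t - \<tau> j) * (periodic_extension (\<tau> j) - periodic_extension t)\<bar> \<le> K (t - \<tau> j) *
          ((2 + 8 * (1 - cos (t - \<tau> j)) / (1 / real N)\<^sup>2) * (2 * ?\<omega>))"
        unfolding abs_mult using K(1)[of "t - \<tau> j"] by (simp only: abs_of_nonneg mult_left_mono)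
    qed
    also have "\<dots> = 2 * ?\<omega> * ((2 + 8 * (real N)\<^sup>2) * (\<Sum>j<N. K (t - \<tau> j))
        - 8 * (real N)\<^sup>2 * (\<Sum>j<N. K (t - \<tau> j) * cos (t - \<tau> j)))"
      unfolding sum_distrib_left sum_subtractf[symmetric]
      by (intro sum.cong refl) (simp add: power_divide algebra_simps)
    also have "\<dots> = 2 * ?\<omega> * (2 + 8 * (real N)\<^sup>2 * (1 - cos (pi / real N)))"
      using K(3,4) by (simp add: \<tau>_def algebra_simps)
    \<comment> \<open>The factor \<open>N^2\<close> from \<open>\<delta> = 1/N\<close> cancels
      against \<open>1 - cos (pi / N) \<le> (pi / N)^2 / 2\<close>, leaving
      \<open>2 + 4 * pi^2 \<le> 2 + 64\<close>; thus 132 is \<open>2 * 66\<close>.\<close>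
    also have "\<dots> \<le> 2 * ?\<omega> * 66"
    proof (intro mult_left_mono)
      have "8 * (real N)\<^sup>2 * (1 - cos (pi / real N)) \<le> 8 * (real N)\<^sup>2 * ((pi / real N)\<^sup>2 / 2)"
        by (intro mult_left_mono one_minus_cos_le) auto
      also have "\<dots> = 4 * pi\<^sup>2" using N by (simp add: power_divide)
      also have "\<dots> \<le> 4 * 4\<^sup>2" using pi_less_4 by (intro mult_left_mono power_mono) auto
      finally show "2 + 8 * (real N)\<^sup>2 * (1 - cos (pi / real N)) \<le> 66" by simp
    qed (use \<omega>0 in simp)
    finally show "\<bar>T t - f t\<bar> \<le> 132 * ?\<omega>" by simp
  qed
qed

end

section \<open>Orthogonal polynomials and Gauss quadrature\<close>

lemma cos_image_open_interval: "cos ` {0<..<pi} = {-1<..<1}"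
proof (intro equalityI subsetI)
  fix y :: real assume "y \<in> cos ` {0<..<pi}"
  then obtain t where t: "0 < t" "t < pi" "y = cos t" by auto
  then have "cos t < cos 0" "cos pi < cos t" by (intro cos_monotone_0_pi; simp)+
  with t show "y \<in> {-1<..<1}" by simp
next
  fix y :: real assume "y \<in> {-1<..<1}"
  then show "y \<in> cos ` {0<..<pi}"
    using arccos_lt_bounded[of y] by (intro image_eqI[where x = "arccos y"]) auto
qed

text \<open>\<open>H t\<close> is the analytic extension at \<open>cos t\<close>. It is continuous
  and positive on the compact interval, so its minum there serves as \<open>c\<close>; inside, it
  equals \<open>w (cos t) * sin t\<close>, which is the weight times the Jacobian of
  \<open>x = cos t\<close>.\<close>

lemma positive_analytic_weight_integral:
  assumes meas: "set_borel_measurable borel {-1..1} w"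
    and nonneg: "\<forall>t\<in>{-1<..<1}. 0 \<le> w t"
    and pos: "positive_analytic_on_interval w"
  obtains H c where "continuous_on {0..pi} H" "0 < c" "\<And>t. t \<in> {0..pi} \<Longrightarrow> c \<le> H t"
    "\<And>p. (\<integral>x. poly p x \<partial>weight_measure w) = integral {0..pi} (\<lambda>t. poly p (cos t) * H t)"
proof -
  obtain U h where U: "open U" "complex_of_real ` {-1..1} \<subseteq> U" "h analytic_on U"
    and hpos: "\<forall>x\<in>{-1..1}. 0 < Re (h (complex_of_real x))"
    and hw: "\<forall>x\<in>{-1<..<1}. h (complex_of_real x) = complex_of_real (w x * sqrt (1 - x^2))"
    using pos unfolding positive_analytic_on_interval_def by blast
  define H where "H t = Re (h (complex_of_real (cos t)))" for t :: real
  have hcont: "continuous_on U h"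
    using U(3) by (simp add: analytic_imp_holomorphic holomorphic_on_imp_continuous_on)
  have Hcont: "continuous_on {0..pi} H"
    unfolding H_def
    by (intro continuous_intros continuous_on_compose2[OF hcont]) (use U(2) in auto)
  obtain t0 where t0: "t0 \<in> {0..pi}" "\<And>t. t \<in> {0..pi} \<Longrightarrow> H t0 \<le> H t"
    using continuous_attains_inf[OF _ _ Hcont] by (metis atLeastatMost_empty_iff compact_Icc pi_ge_zero)
  have int: "(\<integral>x. poly p x \<partial>weight_measure w) = integral {0..pi} (\<lambda>t. poly p (cos t) * H t)"
    for p
  proof -
    define F where "F x = poly p x * w x" for x
    define G where "G t = poly p (cos t) * H t" for t
    have Gcont: "continuous_on {0..pi} G"
      unfolding G_def by (intro continuous_intros Hcont)
    \<comment> \<open>Only interior points are used: at the endpoints nothing relates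
      \<open>w\<close> to \<open>h\<close>.\<close>
    have FG: "\<bar>- sin t\<bar> * F (cos t) = G t" if "t \<in> {0<..<pi}" for t
    proof -
      have s: "sin t > 0" using that by (auto intro: sin_gt_zero)
      then have "sqrt (1 - (cos t)^2) = sin t"
        by (simp add: sin_squared_eq[symmetric])
      moreover have "cos t \<in> {-1<..<1}" using that cos_image_open_interval by blast
      ultimately have "h (complex_of_real (cos t)) = complex_of_real (w (cos t) * sin t)"
        using hw by metis
      then have "H t = w (cos t) * sin t" by (simp add: H_def)
      with s show ?thesis by (simp add: F_def G_def)
    qed
    have "G absolutely_integrable_on {0<..<pi}"
      by (rule set_integrable_subset[OF absolutely_integrable_continuous_real[OF Gcont]]) auto
    moreover have "integral {0<..<pi} G = integral {0..pi} G"
      by (simp add: integral_open_interval_real)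
    moreover have "(\<lambda>t. \<bar>- sin t\<bar> * F (cos t)) absolutely_integrable_on {0<..<pi}
        \<longleftrightarrow> G absolutely_integrable_on {0<..<pi}"
      by (intro set_integrable_cong FG refl)
    moreover have "integral {0<..<pi} (\<lambda>t. \<bar>- sin t\<bar> * F (cos t)) = integral {0<..<pi} G"
      by (intro Henstock_Kurzweil_Integration.integral_cong FG)
    ultimately have "(\<lambda>t. \<bar>- sin t\<bar> * F (cos t)) absolutely_integrable_on {0<..<pi}"
      "integral {0<..<pi} (\<lambda>t. \<bar>- sin t\<bar> * F (cos t)) = integral {0..pi} G"
      by simp_all
    moreover have "(cos has_field_derivative - sin t) (at t within {0<..<pi})" for t :: real
      by (auto intro!: derivative_eq_intros)
    moreover have "inj_on cos {0<..<pi}"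
      by (auto intro!: inj_onI intro: cos_inj_pi)
    ultimately have "F absolutely_integrable_on {-1<..<1} \<and> integral {-1<..<1} F = integral {0..pi} G"
      using has_absolute_integral_change_of_variables_1'
        [of "{0<..<pi}" cos "\<lambda>t. - sin t" F "integral {0..pi} G"]
      by (simp add: cos_image_open_interval)
    then have F: "(LINT x:{-1<..<1}|lebesgue. F x) = integral {0..pi} G"
      using set_lebesgue_integral_eq_integral(2) by metis
    \<comment> \<open>Dropping the two endpoints changes the density on a null set only and makes it
      nonnegative everywhere, as the density formula for integrals requires.\<close>
    define v where "v x = indicator {-1<..<1} x * w x" for x
    have "(\<lambda>x. indicator {-1..1} x *\<^sub>R w x) \<in> borel_measurable borel"
      using meas by (simp add: set_borel_measurable_def)
    then have "(\<lambda>x. indicator {-1<..<1} x * (indicator {-1..1} x *\<^sub>R w x)) \<in> borel_measurable borel"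
      by measurable
    also have "(\<lambda>x. indicator {-1<..<1} x * (indicator {-1..1} x *\<^sub>R w x)) = v"
      by (auto simp: v_def indicator_def)
    finally have v[measurable]: "v \<in> borel_measurable borel" .
    have "weight_measure w = density lborel (\<lambda>x. ennreal (v x))"
      unfolding weight_measure_def
    proof (rule density_cong)
      have "(\<lambda>x. ennreal (indicator {-1..1} x *\<^sub>R w x)) \<in> borel_measurable lborel"
        using \<open>(\<lambda>x. indicator {-1..1} x *\<^sub>R w x) \<in> borel_measurable borel\<close> by simp
      also have "(\<lambda>x. ennreal (indicator {-1..1} x *\<^sub>R w x)) =
          (\<lambda>x. ennreal (w x) * indicator {-1..1} x)"
        by (auto simp: indicator_def)
      finally show "(\<lambda>x. ennreal (w x) * indicator {-1..1} x) \<in> borel_measurable lborel" .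
      have "AE x in lborel. x \<noteq> 1 \<and> x \<noteq> (-1 :: real)"
        using AE_lborel_singleton[of 1] AE_lborel_singleton[of "-1::real"] by auto
      then show "AE x in lborel. ennreal (w x) * indicator {-1..1} x = ennreal (v x)"
        by eventually_elim (auto simp: v_def indicator_def)
    qed simp
    moreover have "0 \<le> v x" for x using nonneg by (simp add: v_def indicator_def)
    moreover have [measurable]: "poly p \<in> borel_measurable borel"
      by (intro borel_measurable_continuous_onI continuous_intros)
    ultimately have "(\<integral>x. poly p x \<partial>weight_measure w) = (\<integral>x. v x * poly p x \<partial>lborel)"
      by (simp add: integral_density)
    \<comment> \<open>The change of variables was done for the completed measure; for a Borel
      measurable integrand both integrals agree.\<close>
    also have "\<dots> = (\<integral>x. v x * poly p x \<partial>lebesgue)"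
      by (rule integral_completion[symmetric]) (simp add: measurable_lborel1)
    also have "\<dots> = (LINT x:{-1<..<1}|lebesgue. F x)"
      unfolding set_lebesgue_integral_def F_def v_def
      by (intro Bochner_Integration.integral_cong) auto
    finally show ?thesis using F by (simp add: G_def[abs_def])
  qed
  show thesis
  proof
    show "0 < H t0" unfolding H_def using hpos by simp
  qed (use Hcont t0 int in auto)
qed

section \<open>Lagrange interpolation and Gauss quadrature for an abstract functional\<close>

lemma lagrange_basis_exists:
  fixes X :: "'a :: field set"
  assumes "finite X"
  obtains l where "\<And>s. s \<in> X \<Longrightarrow> degree (l s) < card X"
    "\<And>s t. s \<in> X \<Longrightarrow> t \<in> X \<Longrightarrow> poly (l s) t = (if s = t then 1 else 0)"
proof -
  define m where "m s = (\<Prod>t\<in>X-{s}. [:-t, 1:])" for s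
  define l where "l s = smult (inverse (poly (m s) s)) (m s)" for s
  have m: "poly (m s) t = (\<Prod>u\<in>X-{s}. t - u)" for s t
    by (simp add: m_def poly_prod)
  show thesis
  proof
    fix s assume s: "s \<in> X"
    have "degree (m s) = card (X - {s})"
      unfolding m_def by (subst degree_prod_eq_sum_degree) auto
    then show "degree (l s) < card X"
      using s assms card_gt_0_iff[of X] by (auto simp: l_def)
    fix t assume t: "t \<in> X"
    have "poly (m s) s \<noteq> 0" using assms by (auto simp: m)
    moreover have "poly (m s) t = 0" if "s \<noteq> t" using assms s t that by (auto simp: m)
    ultimately show "poly (l s) t = (if s = t then 1 else 0)" by (auto simp: l_def)
  qed
qed

lemma lagrange_interpolation:
  fixes X :: "'a :: field set"
  assumes "finite X" "X \<noteq> {}"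
  obtains p where "degree p < card X" "\<And>s. s \<in> X \<Longrightarrow> poly p s = v s"
proof -
  obtain l where l: "\<And>s. s \<in> X \<Longrightarrow> degree (l s) < card X"
    "\<And>s t. s \<in> X \<Longrightarrow> t \<in> X \<Longrightarrow> poly (l s) t = (if s = t then 1 else 0)"
    using lagrange_basis_exists[OF assms(1)] by blast
  show thesis
  proof
    show "degree (\<Sum>s\<in>X. smult (v s) (l s)) < card X"
      using assms l by (intro degree_sum_less) (auto simp: card_gt_0_iff)
    fix t assume t: "t \<in> X"
    have "poly (\<Sum>s\<in>X. smult (v s) (l s)) t = (\<Sum>s\<in>X. if s = t then v s else 0)"
      using l t by (auto simp: poly_sum intro!: sum.cong)
    then show "poly (\<Sum>s\<in>X. smult (v s) (l s)) t = v t" using assms t by simp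
  qed
qed

text \<open>Divide \<open>R = P * A + B\<close>. The quotient has degree below that of
  \<open>P\<close>, so \<open>L (P * A) = 0\<close> by orthogonality, and \<open>B\<close> is its
  own Lagrange interpolant with the values of \<open>R\<close> at the nodes. The weights are
  therefore \<open>L (l s)\<close>.\<close>

lemma gauss_quadrature:
  fixes L :: "real poly \<Rightarrow> real" and P :: "real poly"
  assumes add: "\<And>p q. L (p + q) = L p + L q"
    and smult: "\<And>c p. L (smult c p) = c * L p"
    and nonneg: "\<And>p. 0 \<le> L (p * p)"
    and orth: "\<And>q. degree q < degree P \<Longrightarrow> L (P * q) = 0"
    and X: "finite X" "card X = degree P" "\<And>s. s \<in> X \<Longrightarrow> poly P s = 0"
  obtains wt where "\<And>s. s \<in> X \<Longrightarrow> 0 \<le> wt s"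
    "\<And>R. degree R < 2 * degree P \<Longrightarrow> L R = (\<Sum>s\<in>X. wt s * poly R s)"
proof -
  obtain l where l: "\<And>s. s \<in> X \<Longrightarrow> degree (l s) < card X"
    "\<And>s t. s \<in> X \<Longrightarrow> t \<in> X \<Longrightarrow> poly (l s) t = (if s = t then 1 else 0)"
    using lagrange_basis_exists[OF X(1)] by blast
  have L0: "L 0 = 0" using smult[of 0 0] by simp
  have Lsum: "L (\<Sum>s\<in>A. smult (v s) (l s)) = (\<Sum>s\<in>A. v s * L (l s))" for A v
    by (induction A rule: infinite_finite_induct) (auto simp: L0 add smult)
  have exact: "L R = (\<Sum>s\<in>X. L (l s) * poly R s)" if R: "degree R < 2 * degree P" for R
  proof -
    define A B where "A = R div P" and "B = R mod P"
    have P: "degree P > 0" using R by simp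
    have RAB: "R = P * A + B" by (simp add: A_def B_def)
    have B: "degree B < degree P" unfolding B_def using degree_mod_less[of P R] P by force
    have A: "degree A < degree P"
    proof (rule ccontr)
      assume c: "\<not> degree A < degree P"
      then have "A \<noteq> 0" "P \<noteq> 0" using P by auto
      then have d: "degree (P * A) = degree P + degree A" by (rule degree_mult_eq[rotated])
      with B have "degree R = degree P + degree A"
        unfolding RAB by (subst degree_add_eq_left) auto
      with c R show False by simp
    qed
    have "B = (\<Sum>s\<in>X. smult (poly B s) (l s))"
    proof (rule poly_eqI_degree[where A = X])
      fix t assume t: "t \<in> X"
      have "poly (\<Sum>s\<in>X. smult (poly B s) (l s)) t = (\<Sum>s\<in>X. if s = t then poly B s else 0)"
        using l t by (auto simp: poly_sum intro!: sum.cong)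
      then show "poly B t = poly (\<Sum>s\<in>X. smult (poly B s) (l s)) t" using X t by simp
    next
      show "degree B < card X" using B X by simp
      show "degree (\<Sum>s\<in>X. smult (poly B s) (l s)) < card X"
        using P X l by (intro degree_sum_less) auto
    qed
    then have "L B = (\<Sum>s\<in>X. poly B s * L (l s))" using Lsum by metis
    also have "\<dots> = (\<Sum>s\<in>X. L (l s) * poly R s)"
      using X(3) by (intro sum.cong) (simp_all add: RAB)
    finally show ?thesis unfolding RAB add using orth[OF A] by simp
  qed
  show thesis
  proof
    fix s assume s: "s \<in> X"
    \<comment> \<open>The quadrature is exact for the square of \<open>l s\<close>, which has the
      same node values as \<open>l s\<close>; so each weight is \<open>L\<close> of a
      square.\<close>
    have "degree (l s * l s) < 2 * degree P"
      using degree_mult_le[of "l s" "l s"] l(1)[OF s] X by simp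
    then have "L (l s * l s) = (\<Sum>t\<in>X. if s = t then L (l t) else 0)"
      using s l by (auto simp: exact intro!: sum.cong)
    then have "L (l s * l s) = L (l s)" using s X by simp
    then show "0 \<le> L (l s)" using nonneg by metis
  qed (rule exact)
qed

text \<open>\<open>S\<close> collects the roots of odd order in the open interval, that is, the sign
  changes. The induction splits off one linear factor at a time; without roots inside, the
  intermediate value theorem excludes a sign change.\<close>

lemma sign_changing_factor:
  fixes p :: "real poly"
  assumes "p \<noteq> 0" "a < b"
  shows "\<exists>S. finite S \<and> S \<subseteq> {a<..<b} \<and> (\<forall>s\<in>S. poly p s = 0) \<and>
           ((\<forall>x\<in>{a..b}. 0 \<le> poly (p * (\<Prod>s\<in>S. [:-s, 1:])) x) \<or>
            (\<forall>x\<in>{a..b}. poly (p * (\<Prod>s\<in>S. [:-s, 1:])) x \<le> 0))"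
  using assms(1)
proof (induction "degree p" arbitrary: p rule: less_induct)
  case less
  show ?case
  proof (cases "\<exists>c\<in>{a<..<b}. poly p c = 0")
    case False
    have "(\<forall>x\<in>{a..b}. 0 \<le> poly p x) \<or> (\<forall>x\<in>{a..b}. poly p x \<le> 0)"
    proof (rule ccontr)
      assume "\<not> ?thesis"
      then obtain x y where xy: "x \<in> {a..b}" "y \<in> {a..b}" "poly p x < 0" "poly p y > 0"
        by (auto simp: not_le)
      have "x \<noteq> y" using xy by auto
      then consider "x < y" | "y < x" by linarith
      then show False
      proof cases
        case 1 with poly_IVT_pos[OF 1 xy(3,4)] xy False show ?thesis by fastforce
      next
        case 2 with poly_IVT_neg[OF 2 xy(4,3)] xy False show ?thesis by fastforce
      qed
    qed
    then show ?thesis by (intro exI[of _ "{}"]) auto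
  next
    case True
    then obtain c where c: "c \<in> {a<..<b}" "poly p c = 0" by blast
    then obtain r where r: "p = [:-c, 1:] * r"
      unfolding poly_eq_0_iff_dvd dvd_def by blast
    then have r0: "r \<noteq> 0" using less.prems by auto
    then have "degree r < degree p" using degree_mult_eq[of "[:-c, 1:]" r] by (simp only: r) simp
    from less.hyps[OF this r0] obtain S where S: "finite S" "S \<subseteq> {a<..<b}"
      "\<forall>s\<in>S. poly r s = 0"
      and sgn: "(\<forall>x\<in>{a..b}. 0 \<le> poly (r * (\<Prod>s\<in>S. [:-s, 1:])) x) \<or>
            (\<forall>x\<in>{a..b}. poly (r * (\<Prod>s\<in>S. [:-s, 1:])) x \<le> 0)" by blast
    \<comment> \<open>The new root toggles membership in \<open>S\<close>: if present it is removed
      and the product stays the same polynomial, otherwise it is added and the product gains the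
      square factor \<open>(x - c)^2\<close>.\<close>
    show ?thesis
    proof (cases "c \<in> S")
      case True
      then have "(\<Prod>s\<in>S. [:-s, 1:]) = [:-c, 1:] * (\<Prod>s\<in>S-{c}. [:-s, 1:])"
        using S by (intro prod.remove)
      then have "p * (\<Prod>s\<in>S-{c}. [:-s, 1:]) = r * (\<Prod>s\<in>S. [:-s, 1:])"
        unfolding r by (simp only: ac_simps)
      then show ?thesis using S sgn r by (intro exI[of _ "S - {c}"]) auto
    next
      case False
      have "p * (\<Prod>s\<in>insert c S. [:-s, 1:]) = [:-c, 1:]^2 * (r * (\<Prod>s\<in>S. [:-s, 1:]))"
        unfolding r power2_eq_square prod.insert[OF S(1) False] by (simp only: ac_simps)
      then have *: "poly (p * (\<Prod>s\<in>insert c S. [:-s, 1:])) x =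
          (x - c)^2 * poly (r * (\<Prod>s\<in>S. [:-s, 1:])) x" for x
        by (simp add: poly_power)
      have "finite (insert c S) \<and> insert c S \<subseteq> {a<..<b} \<and> (\<forall>s\<in>insert c S. poly p s = 0)"
        using S c r by auto
      moreover have "(\<forall>x\<in>{a..b}. 0 \<le> poly (p * (\<Prod>s\<in>insert c S. [:-s, 1:])) x) \<or>
            (\<forall>x\<in>{a..b}. poly (p * (\<Prod>s\<in>insert c S. [:-s, 1:])) x \<le> 0)"
        unfolding * using sgn by (meson mult_nonneg_nonneg mult_nonneg_nonpos zero_le_power2)
      ultimately show ?thesis by blast
    qed
  qed
qed

section \<open>The weighted functional, zeros of orthogonal polynomials and bounds for
  interpolants\<close>

context
  fixes H :: "real \<Rightarrow> real" and c :: real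
  assumes H: "continuous_on {0..pi} H" and c: "0 < c" and cH: "\<And>t. t \<in> {0..pi} \<Longrightarrow> c \<le> H t"
begin

definition cos_integral :: "real poly \<Rightarrow> real" where
  "cos_integral p = integral {0..pi} (\<lambda>t. poly p (cos t) * H t)"

lemma integrable_poly_cos: "(\<lambda>t. poly p (cos t) * H t) integrable_on {0..pi}"
  by (intro integrable_continuous_real continuous_intros H)

lemma cos_integral_add: "cos_integral (p + q) = cos_integral p + cos_integral q"
  unfolding cos_integral_def
  by (simp add: distrib_right Henstock_Kurzweil_Integration.integral_add integrable_poly_cos)

lemma cos_integral_smult: "cos_integral (smult a p) = a * cos_integral p"
  unfolding cos_integral_def by (simp add: mult.assoc)

text \<open>Removes the weight, so that the unweighted mean square bounds can be applied.\<close>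

lemma cos_integral_ge:
  assumes "\<And>x. x \<in> {-1..1} \<Longrightarrow> 0 \<le> poly p x"
  shows "c * integral {0..pi} (\<lambda>t. poly p (cos t)) \<le> cos_integral p"
proof -
  have "integral {0..pi} (\<lambda>t. c * poly p (cos t)) \<le> cos_integral p"
    unfolding cos_integral_def
  proof (intro integral_le integrable_poly_cos integrable_continuous_real continuous_intros)
    fix t assume "t \<in> {0..pi}"
    then show "c * poly p (cos t) \<le> poly p (cos t) * H t"
      using mult_right_mono[OF cH[of t] assms[of "cos t"]] by (simp add: mult.commute)
  qed
  then show ?thesis by simp
qed

text \<open>A continuous nonnegative integrand with zero integral vanishes identically; as
  \<open>H > 0\<close>, \<open>p\<close> would then have infinitely many roots.\<close>

lemma cos_integral_pos:
  assumes p: "p \<noteq> 0" and nonneg: "\<And>x. x \<in> {-1..1} \<Longrightarrow> 0 \<le> poly p x"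
  shows "0 < cos_integral p"
proof -
  have nn: "0 \<le> poly p (cos t) * H t" if "t \<in> {0..pi}" for t
    using nonneg[of "cos t"] cH[OF that] c by simp
  have cont: "continuous_on {0..pi} (\<lambda>t. poly p (cos t) * H t)" by (intro continuous_intros H)
  have "cos_integral p \<noteq> 0"
  proof
    assume "cos_integral p = 0"
    then have 0: "poly p (cos t) * H t = 0" if "t \<in> {0..pi}" for t
      using integral_eq_0_iff[OF cont] nn that by (simp add: cos_integral_def)
    have "poly p x = 0" if "x \<in> {-1..1}" for x
      using 0[of "arccos x"] cH[of "arccos x"] c that by (auto simp: arccos_lbound arccos_ubound)
    then have "{-1..1} \<subseteq> {x. poly p x = 0}" by auto
    then have "finite {-1..1::real}" using poly_roots_finite[OF p] finite_subset by blast
    then show False by (simp add: infinite_Icc)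
  qed
  moreover have "0 \<le> cos_integral p"
    unfolding cos_integral_def using nn by (intro integral_nonneg integrable_poly_cos) auto
  ultimately show ?thesis by simp
qed

lemma cos_integral_square_nonneg: "0 \<le> cos_integral (p * p)"
  using cos_integral_pos[of "p * p"] cos_integral_smult[of 0 0] by (cases "p = 0") auto

context
  fixes P :: "real poly" and n :: nat
  assumes P: "degree P = n" "lead_coeff P = 1"
    and orth: "\<And>q. degree q < n \<Longrightarrow> cos_integral (P * q) = 0"
begin

text \<open>Multiply \<open>P\<close> by the linear factors of its sign changes in the open
  interval. The product has constant sign, hence a nonzero integral, so orthogonality forces at
  least \<open>n\<close> sign changes. A polynomial of degree \<open>n\<close> has no further
  roots.\<close>

lemma orthogonal_poly_zeros:
  "{s. poly P s = 0} \<subseteq> {-1<..<1}" "card {s. poly P s = 0} = n" "finite {s. poly P s = 0}"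
proof -
  have P0: "P \<noteq> 0" using P(2) by auto
  show fin: "finite {s. poly P s = 0}" by (rule poly_roots_finite[OF P0])
  obtain S where S: "finite S" "S \<subseteq> {-1<..<1}" "\<forall>s\<in>S. poly P s = 0"
    and sgn: "(\<forall>x\<in>{-1..1}. 0 \<le> poly (P * (\<Prod>s\<in>S. [:-s, 1:])) x) \<or>
            (\<forall>x\<in>{-1..1}. poly (P * (\<Prod>s\<in>S. [:-s, 1:])) x \<le> 0)"
    using sign_changing_factor[OF P0, of "-1" 1] by auto
  define Q where "Q = (\<Prod>s\<in>S. [:-s, 1:])"
  have Q0: "Q \<noteq> 0" unfolding Q_def using S(1) by (simp add: prod_zero_iff)
  have degQ: "degree Q = card S" unfolding Q_def by (subst degree_prod_eq_sum_degree) auto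
  have "cos_integral (P * Q) \<noteq> 0"
    using sgn
  proof
    assume "\<forall>x\<in>{-1..1}. 0 \<le> poly (P * (\<Prod>s\<in>S. [:-s, 1:])) x"
    then have "0 < cos_integral (P * Q)"
      using P0 Q0 by (intro cos_integral_pos) (auto simp: Q_def)
    then show ?thesis by simp
  next
    assume "\<forall>x\<in>{-1..1}. poly (P * (\<Prod>s\<in>S. [:-s, 1:])) x \<le> 0"
    then have "0 < cos_integral (smult (-1) (P * Q))"
      using P0 Q0 by (intro cos_integral_pos) (auto simp: Q_def)
    then show ?thesis by (simp only: cos_integral_smult)
  qed
  then have ge: "n \<le> card S" using orth[of Q] unfolding degQ by linarith
  have le: "card {s. poly P s = 0} \<le> n" using card_poly_roots_bound[OF P0] P(1) by simp
  have "S \<subseteq> {s. poly P s = 0}" using S by auto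
  then have eq: "S = {s. poly P s = 0}"
    using order_trans[OF le ge] by (rule card_seteq[OF fin])
  with ge le have "card S = n" by (simp only: le_antisym)
  with S(2) show "{s. poly P s = 0} \<subseteq> {-1<..<1}" "card {s. poly P s = 0} = n"
    unfolding eq by blast+
qed

text \<open>
  Gauss quadrature is exact for \<open>p\<^sup>2\<close> but not for \<open>(1 - x\<^sup>2) q\<^sup>2\<close>, whose degree may be \<open>2n\<close>. Adding
  \<open>k\<^sup>2 P\<^sup>2\<close>, where \<open>k\<close> is the leading coefficient of \<open>q\<close>, cancels the top coefficient without changing
  the values at the nodes, so in the second case the quadrature errs on the favourable side.
\<close>

lemma interpolant_bound:
  assumes p: "degree p < n" and q: "degree q < n"
    and e: "\<And>s. poly P s = 0 \<Longrightarrow> (poly p s)\<^sup>2 + (1 - s\<^sup>2) * (poly q s)\<^sup>2 \<le> e"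
  shows "(poly p (cos t) + sin t * poly q (cos t))\<^sup>2 \<le> 4 * n / (pi * c) * cos_integral 1 * e"
proof -
  define X where "X = {s. poly P s = 0}"
  obtain wt where wt: "\<And>s. s \<in> X \<Longrightarrow> 0 \<le> wt s"
    "\<And>R. degree R < 2 * degree P \<Longrightarrow> cos_integral R = (\<Sum>s\<in>X. wt s * poly R s)"
  proof (rule gauss_quadrature[of cos_integral P X])
    show "cos_integral (P * q) = 0" if "degree q < degree P" for q
      using that by (simp add: P(1) orth)
    show "finite X" "card X = degree P" unfolding X_def P(1) by (rule orthogonal_poly_zeros)+
  qed (auto simp: cos_integral_add cos_integral_smult cos_integral_square_nonneg X_def)
  have n: "0 < n" using p by simp
  have pp: "cos_integral (p * p) = (\<Sum>s\<in>X. wt s * (poly p s)\<^sup>2)"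
    using degree_mult_le[of p p] p P(1) by (subst wt(2)) (auto simp: power2_eq_square)
  define W where "W = [:1, 0, -1:] * (q * q)"
  have polyW: "poly W s = (1 - s\<^sup>2) * (poly q s)\<^sup>2" for s
    by (simp add: W_def power2_eq_square algebra_simps)
  define k where "k = (if degree W < 2 * n then 0 else lead_coeff q)"
  define V where "V = W + smult (k\<^sup>2) (P * P)"
  have "degree V < 2 * n"
  proof (cases "degree W < 2 * n")
    case True
    then show ?thesis by (simp add: V_def k_def)
  next
    case False
    then have q0: "q \<noteq> 0" using n by (auto simp: W_def)
    have P0: "P \<noteq> 0" using P(2) by auto
    have dW: "degree W = 2 + 2 * degree q"
      unfolding W_def using q0 by (subst degree_mult_eq) (auto simp: degree_mult_eq)
    have lW: "lead_coeff W = - (lead_coeff q)\<^sup>2"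
      unfolding W_def lead_coeff_mult by (simp add: power2_eq_square)
    have dP: "degree (P * P) = 2 * n" using P0 P(1) by (simp add: degree_mult_eq)
    have lP: "lead_coeff (P * P) = 1" unfolding lead_coeff_mult using P(2) by simp
    have "degree W = 2 * n" using False dW q by linarith
    then have "coeff V (2 * n) = 0"
      using lW lP dP False by (simp add: V_def k_def)
    moreover have "degree V \<le> 2 * n"
      unfolding V_def using \<open>degree W = 2 * n\<close> dP
      by (intro degree_add_le) (auto intro: order_trans[OF degree_smult_le])
    \<comment> \<open>Degree exactly \<open>2 * n\<close> would make the leading coefficient zero,
      hence \<open>V = 0\<close> of degree 0, against \<open>n > 0\<close>.\<close>
    ultimately show ?thesis
      using n leading_coeff_0_iff[of V] by (cases "degree V = 2 * n") (simp_all only:, auto)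
  qed
  then have "cos_integral V = (\<Sum>s\<in>X. wt s * poly V s)" using P(1) by (intro wt(2)) simp
  also have "\<dots> = (\<Sum>s\<in>X. wt s * ((1 - s\<^sup>2) * (poly q s)\<^sup>2))"
    by (intro sum.cong) (auto simp: V_def polyW X_def)
  finally have WX: "cos_integral W \<le> (\<Sum>s\<in>X. wt s * ((1 - s\<^sup>2) * (poly q s)\<^sup>2))"
    using mult_nonneg_nonneg[OF zero_le_power2[of k] cos_integral_square_nonneg[of P]]
    unfolding V_def cos_integral_add cos_integral_smult by linarith
  have "cos_integral (p * p) + cos_integral W \<le>
      (\<Sum>s\<in>X. wt s * ((poly p s)\<^sup>2 + (1 - s\<^sup>2) * (poly q s)\<^sup>2))"
    using WX by (simp add: pp distrib_left sum.distrib)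
  also have "\<dots> \<le> (\<Sum>s\<in>X. wt s * e)"
    using e wt(1) by (intro sum_mono mult_left_mono) (auto simp: X_def)
  \<comment> \<open>The quadrature of the constant 1 shows that the weights add up to
    \<open>cos_integral 1\<close>.\<close>
  also have "\<dots> = cos_integral 1 * e"
    using n P(1) by (subst wt(2)) (auto simp: sum_distrib_right)
  finally have sum_le: "cos_integral (p * p) + cos_integral W \<le> cos_integral 1 * e" .
  define A where "A = integral {0..pi} (\<lambda>t. (poly p (cos t))\<^sup>2)"
  define B where "B = integral {0..pi} (\<lambda>t. (sin t * poly q (cos t))\<^sup>2)"
  have A_le: "c * A \<le> cos_integral (p * p)"
    using cos_integral_ge[of "p * p"] by (simp add: A_def power2_eq_square)
  have "poly W (cos t) = (sin t * poly q (cos t))\<^sup>2" for t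
    by (simp add: polyW power_mult_distrib sin_squared_eq)
  moreover have W_nonneg: "0 \<le> poly W s" if "s \<in> {-1..1}" for s
    using that abs_square_le_1[of s] by (simp add: polyW abs_le_iff)
  ultimately have B_le: "c * B \<le> cos_integral W"
    using cos_integral_ge[of W] by (simp add: B_def)
  define u v where "u = poly p (cos t)" and "v = sin t * poly q (cos t)"
  have "(u + v)\<^sup>2 \<le> 2 * u\<^sup>2 + 2 * v\<^sup>2"
    using zero_le_power2[of "u - v"] by (simp add: power2_sum power2_diff)
  also have "\<dots> \<le> 2 * (2 * n / pi * A) + 2 * (2 * n / pi * B)"
    using nikolskii_poly_cos[OF p, of t] nikolskii_sin_poly_cos[OF q, of t]
    unfolding u_def v_def A_def B_def by linarith
  \<comment> \<open>The constant collects a factor 2 from splitting the square,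
    \<open>2 * n / pi\<close> from the Nikolskii bounds, and \<open>1 / c\<close> from removing the
    weight.\<close>
  also have "\<dots> = 4 * n / (pi * c) * (c * A + c * B)"
    using c by (simp add: field_simps)
  also have "\<dots> \<le> 4 * n / (pi * c) * (cos_integral 1 * e)"
    using A_le B_le sum_le c by (intro mult_left_mono) auto
  finally show ?thesis by (simp add: u_def v_def mult.assoc)
qed

text \<open>The nodes come in mirror pairs with the same cosine and opposite sines. So
  \<open>p\<close> interpolates the half sum of the data at a pair, and \<open>q\<close> the half
  difference divided by the sine, which is nonzero because the zeros of \<open>P\<close> lie
  strictly between -1 and 1.\<close>

lemma interpolant_exists:
  assumes n: "0 < n" and r: "\<And>t. t \<in> {0..2*pi} \<Longrightarrow> \<bar>r t\<bar> \<le> e"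
  obtains R where "trig_poly n R"
    "\<And>s. poly P s = 0 \<Longrightarrow> R (arccos s) = r (arccos s) \<and> R (2*pi - arccos s) = r (2*pi - arccos s)"
    "\<And>t. \<bar>R t\<bar> \<le> sqrt (4 / (pi * c) * cos_integral 1) * sqrt n * e"
proof -
  define X where "X = {s. poly P s = 0}"
  have X: "finite X" "X \<noteq> {}" "card X = n" "X \<subseteq> {-1<..<1}"
    using orthogonal_poly_zeros n by (auto simp: X_def)
  obtain p where p: "degree p < n"
    "\<And>s. s \<in> X \<Longrightarrow> poly p s = (r (arccos s) + r (2*pi - arccos s)) / 2"
    using lagrange_interpolation[OF X(1,2), unfolded X(3),
          where v = "\<lambda>s. (r (arccos s) + r (2*pi - arccos s)) / 2"] by blast
  obtain q where q: "degree q < n"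
    "\<And>s. s \<in> X \<Longrightarrow> poly q s = (r (arccos s) - r (2*pi - arccos s)) / (2 * sin (arccos s))"
    using lagrange_interpolation[OF X(1,2), unfolded X(3),
          where v = "\<lambda>s. (r (arccos s) - r (2*pi - arccos s)) / (2 * sin (arccos s))"] by blast
  define R where "R t = poly p (cos t) + sin t * poly q (cos t)" for t
  have e: "0 \<le> e" using r[of 0] by simp
  have sinX: "sin (arccos s) > 0" "cos (arccos s) = s" "(sin (arccos s))\<^sup>2 = 1 - s\<^sup>2"
    "arccos s \<in> {0..2*pi}" "2*pi - arccos s \<in> {0..2*pi}" if "s \<in> X" for s
  proof -
    have s: "-1 < s" "s < 1" using X(4) that by auto
    then have a: "0 < arccos s" "arccos s < pi" using arccos_lt_bounded by auto
    then show "sin (arccos s) > 0" by (rule sin_gt_zero)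
    show "cos (arccos s) = s" using s by simp
    then show "(sin (arccos s))\<^sup>2 = 1 - s\<^sup>2" by (simp add: sin_squared_eq)
    show "arccos s \<in> {0..2*pi}" "2*pi - arccos s \<in> {0..2*pi}" using a by auto
  qed
  show thesis
  proof
    have "in_span (\<lambda>k t. cos (real k * t)) {..n} (\<lambda>t. poly p (cos t))"
      using p by (intro poly_cos_in_span) auto
    with sin_poly_cos_in_span[OF q(1)] show "trig_poly n R"
      unfolding trig_poly_iff R_def by (intro exI conjI) auto
    show "R (arccos s) = r (arccos s) \<and> R (2*pi - arccos s) = r (2*pi - arccos s)"
      if "poly P s = 0" for s
    proof -
      have s: "s \<in> X" using that by (simp add: X_def)
      have "sin (2*pi - arccos s) = - sin (arccos s)" "cos (2*pi - arccos s) = cos (arccos s)"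
        by (simp_all add: sin_diff cos_diff)
      moreover have "sin (arccos s) * poly q s = (r (arccos s) - r (2*pi - arccos s)) / 2"
        using sinX(1)[OF s] by (simp add: q(2)[OF s])
      ultimately have
        "R (arccos s) = (r (arccos s) + r (2*pi - arccos s)) / 2 + (r (arccos s) - r (2*pi - arccos s)) / 2"
        "R (2*pi - arccos s) =
          (r (arccos s) + r (2*pi - arccos s)) / 2 - (r (arccos s) - r (2*pi - arccos s)) / 2"
        by (simp_all only: R_def sinX(2)[OF s] p(2)[OF s] mult_minus_left diff_conv_add_uminus)
      then show ?thesis by (simp add: field_simps)
    qed
    fix t
    have "(R t)\<^sup>2 \<le> 4 * n / (pi * c) * cos_integral 1 * e\<^sup>2"
      unfolding R_def
    proof (rule interpolant_bound[OF p(1) q(1)])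
      fix s assume "poly P s = 0"
      then have s: "s \<in> X" by (simp add: X_def)
      let ?u = "r (arccos s)" and ?v = "r (2*pi - arccos s)"
      \<comment> \<open>The squares of half sum and half difference add up to the mean of the two
        squared data, which is at most \<open>e^2\<close>.\<close>
      have "(1 - s\<^sup>2) * (poly q s)\<^sup>2 = ((?u - ?v) / 2)\<^sup>2"
        unfolding sinX(3)[OF s, symmetric] power_mult_distrib[symmetric]
        using sinX(1)[OF s] by (simp add: q(2)[OF s])
      then have "(poly p s)\<^sup>2 + (1 - s\<^sup>2) * (poly q s)\<^sup>2 = (?u\<^sup>2 + ?v\<^sup>2) / 2"
        by (simp add: p(2)[OF s] power2_eq_square field_simps)
      moreover have "?u\<^sup>2 \<le> e\<^sup>2" "?v\<^sup>2 \<le> e\<^sup>2"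
        using r[OF sinX(4)[OF s]] r[OF sinX(5)[OF s]] e by (simp_all add: abs_le_square_iff[symmetric])
      ultimately show "(poly p s)\<^sup>2 + (1 - s\<^sup>2) * (poly q s)\<^sup>2 \<le> e\<^sup>2" by simp
    qed
    then have "sqrt ((R t)\<^sup>2) \<le> sqrt (4 / (pi * c) * cos_integral 1 * n * e\<^sup>2)"
      by (intro real_sqrt_le_mono) (simp add: mult_ac)
    then show "\<bar>R t\<bar> \<le> sqrt (4 / (pi * c) * cos_integral 1) * sqrt n * e"
      using e by (simp only: real_sqrt_mult real_sqrt_abs abs_of_nonneg)
  qed
qed

end

end

section \<open>Convergence of the interpolants\<close>

theorem theorem6:
  fixes f w :: "real \<Rightarrow> real" and \<mu> :: "real measure"
    and P :: "nat \<Rightarrow> real poly" and x \<theta> :: "nat \<Rightarrow> nat \<Rightarrow> real"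
  assumes "continuous_on {0..2*pi} f"
    and "f 0 = f (2*pi)"
    and "(\<lambda>\<delta>. modulus_of_continuity f \<delta>) \<in> o[at_right 0](\<lambda>\<delta>. \<delta> powr (1/2))"
    and "set_borel_measurable borel {-1..1} w"
    and "\<forall>t\<in>{-1<..<1}. 0 \<le> w t"
    and "\<mu> = weight_measure w"
    and "finite_measure \<mu>"
    and "szego_condition w"
    and "positive_analytic_on_interval w"
    and "\<forall>n. monic_orthogonal_poly \<mu> n (P n)"
    and "\<forall>n. x n ` {1..n} = {t. poly (P n) t = 0}"
    and "\<forall>n. \<forall>j\<in>{1..n}. \<theta> n j = arccos (x n j)"
    and "\<forall>n. \<forall>j\<in>{1..n}. \<theta> n (n + j) = 2*pi - \<theta> n (n - j + 1)"
  shows "\<exists>\<tau> :: nat \<Rightarrow> real \<Rightarrow> real.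
           (\<forall>n. trig_poly n (\<tau> n) \<and> (\<forall>j\<in>{1..2*n}. \<tau> n (\<theta> n j) = f (\<theta> n j))) \<and>
           uniform_limit {0..2*pi} \<tau> f sequentially"
proof -
  obtain H c where H: "continuous_on {0..pi} H" "0 < c" "\<And>t. t \<in> {0..pi} \<Longrightarrow> c \<le> H t"
    and int: "\<And>p. (\<integral>x. poly p x \<partial>\<mu>) = integral {0..pi} (\<lambda>t. poly p (cos t) * H t)"
    using positive_analytic_weight_integral[OF assms(4,5,9)] unfolding assms(6) by metis
  \<comment> \<open>\<open>D * sqrt n\<close> bounds the norm of the interpolation operator of
    degree \<open>n\<close>.\<close>
  define D where "D = sqrt (4 / (pi * c) * cos_integral H 1)"
  let ?\<omega> = "\<lambda>n. modulus_of_continuity f (1 / real n)"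
  have L: "cos_integral H p = (\<integral>x. poly p x \<partial>\<mu>)" for p
    by (simp only: cos_integral_def[OF H] int)
  have D: "0 \<le> D"
    using H(2) cos_integral_square_nonneg[OF H, of 1] by (simp add: D_def)
  have \<omega>0: "0 \<le> ?\<omega> n" if "0 < n" for n
    using modulus_of_continuity_ge[OF assms(1), of 0 0 "1 / real n"] that by simp
  have "\<exists>\<tau>. trig_poly n \<tau> \<and> (\<forall>j\<in>{1..2*n}. \<tau> (\<theta> n j) = f (\<theta> n j)) \<and>
      (0 < n \<longrightarrow> (\<forall>t\<in>{0..2*pi}. \<bar>\<tau> t - f t\<bar> \<le> 132 * (1 + D) * (sqrt n * ?\<omega> n)))" for n
  proof (cases "n = 0")
    \<comment> \<open>There are no nodes for \<open>n = 0\<close>, and the error bound is claimed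
      for positive \<open>n\<close> only, so the zero polynomial will do.\<close>
    case True
    then show ?thesis using trig_poly_zero by auto
  next
    case False
    then have n: "1 \<le> n" "0 < n" by auto
    obtain T where T: "trig_poly (n - 1) T"
      "\<And>t. t \<in> {0..2*pi} \<Longrightarrow> \<bar>T t - f t\<bar> \<le> 132 * ?\<omega> n"
      using jackson_trigonometric[OF assms(1,2) n(1)] by blast
    have P: "degree (P n) = n" "lead_coeff (P n) = 1"
      "\<And>q. degree q < n \<Longrightarrow> cos_integral H (P n * q) = 0"
      using assms(10) unfolding monic_orthogonal_poly_def by (blast, blast, simp add: L)
    have fT: "\<bar>f t - T t\<bar> \<le> 132 * ?\<omega> n" if "t \<in> {0..2*pi}" for t
      using T(2)[OF that] by (simp add: abs_minus_commute)
    obtain R where R: "trig_poly n R"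
      "\<And>s. poly (P n) s = 0 \<Longrightarrow> R (arccos s) = f (arccos s) - T (arccos s) \<and>
          R (2*pi - arccos s) = f (2*pi - arccos s) - T (2*pi - arccos s)"
      "\<And>t. \<bar>R t\<bar> \<le> D * sqrt n * (132 * ?\<omega> n)"
    proof (rule interpolant_exists[where H = H and c = c and P = "P n" and n = n
          and r = "\<lambda>t. f t - T t" and e = "132 * ?\<omega> n"])
      show "continuous_on {0..pi} H" "0 < c" "degree (P n) = n" "lead_coeff (P n) = 1" "0 < n"
        by fact+
      show "c \<le> H t" if "t \<in> {0..pi}" for t using that by (rule H)
      show "cos_integral H (P n * q) = 0" if "degree q < n" for q using that by (rule P)
      show "\<bar>f t - T t\<bar> \<le> 132 * ?\<omega> n" if "t \<in> {0..2*pi}" for t using that by (rule fT)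
    qed (unfold D_def[symmetric], rule that)
    have root: "poly (P n) (x n j) = 0" if "j \<in> {1..n}" for j
      using assms(11) that by blast
    show ?thesis
    \<comment> \<open>The Jackson polynomial is corrected by the interpolant \<open>R\<close> of
      \<open>f - T\<close>, whose data are small.\<close>
    proof (intro exI[of _ "\<lambda>t. T t + R t"] conjI ballI impI)
      show "trig_poly n (\<lambda>t. T t + R t)"
        using T(1) R(1) by (intro trig_poly_add) (auto intro: trig_poly_mono)
      fix j assume j: "j \<in> {1..2*n}"
      show "T (\<theta> n j) + R (\<theta> n j) = f (\<theta> n j)"
      proof (cases "j \<le> n")
        case True
        then have j': "j \<in> {1..n}" using j by simp
        then have "\<theta> n j = arccos (x n j)" using assms(12) by blast
        then show ?thesis using R(2)[OF root[OF j']] by simp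
      next
        case False
        define i where "i = j - n"
        have i: "i \<in> {1..n}" "n - i + 1 \<in> {1..n}" "j = n + i" using False j by (auto simp: i_def)
        have "\<theta> n j = 2*pi - \<theta> n (n - i + 1)" using assms(13) i(1,3) by blast
        also have "\<theta> n (n - i + 1) = arccos (x n (n - i + 1))" using assms(12) i(2) by blast
        finally have "\<theta> n j = 2*pi - arccos (x n (n - i + 1))" .
        then show ?thesis using R(2)[OF root[OF i(2)]] by simp
      qed
    next
      fix t assume "t \<in> {0..2*pi}"
      then have "\<bar>T t + R t - f t\<bar> \<le> 132 * ?\<omega> n * 1 + D * sqrt n * (132 * ?\<omega> n)"
        using T(2)[of t] R(3)[of t] by linarith
      \<comment> \<open>Since \<open>sqrt n \<ge> 1\<close>, the Jackson error is absorbed into the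
        same order as the correction.\<close>
      also have "\<dots> \<le> 132 * ?\<omega> n * sqrt n + D * sqrt n * (132 * ?\<omega> n)"
        using n \<omega>0 by (intro add_right_mono mult_left_mono) auto
      finally show "\<bar>T t + R t - f t\<bar> \<le> 132 * (1 + D) * (sqrt n * ?\<omega> n)"
        by (simp add: algebra_simps)
    qed
  qed
  then obtain \<tau> where \<tau>: "\<And>n. trig_poly n (\<tau> n)"
    "\<And>n j. j \<in> {1..2*n} \<Longrightarrow> \<tau> n (\<theta> n j) = f (\<theta> n j)"
    "\<And>n t. 0 < n \<Longrightarrow> t \<in> {0..2*pi} \<Longrightarrow> \<bar>\<tau> n t - f t\<bar> \<le> 132 * (1 + D) * (sqrt n * ?\<omega> n)"
    by metis
  \<comment> \<open>Substituting \<open>\<delta> = 1/n\<close> into the little-o hypothesis turns it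
    into \<open>sqrt n * modulus_of_continuity f (1/n)\<close> tending to 0, exactly the size of the
    error bound.\<close>
  have "filterlim (\<lambda>n. 1 / real n) (at_right 0) sequentially"
    by (intro tendsto_imp_filterlim_at_right lim_1_over_n eventually_sequentiallyI[of 1]) simp
  from landau_o.small.compose[OF assms(3) this]
  have "(\<lambda>n. ?\<omega> n / (1 / real n) powr (1/2)) \<longlonglongrightarrow> 0" by (rule smalloD_tendsto)
  then have "(\<lambda>n. 132 * (1 + D) * (?\<omega> n / (1 / real n) powr (1/2))) \<longlonglongrightarrow> 0"
    by (rule tendsto_mult_right_zero)
  moreover have "?\<omega> n / (1 / real n) powr (1/2) = sqrt n * ?\<omega> n" for n
    by (simp add: powr_half_sqrt real_sqrt_divide)
  ultimately have lim: "(\<lambda>n. 132 * (1 + D) * (sqrt n * ?\<omega> n)) \<longlonglongrightarrow> 0" by simp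
  have "uniform_limit {0..2*pi} \<tau> f sequentially"
  proof (rule uniform_limitI)
    fix e :: real assume "0 < e"
    from order_tendstoD(2)[OF lim this] eventually_gt_at_top[of 0]
    show "\<forall>\<^sub>F n in sequentially. \<forall>t\<in>{0..2*pi}. dist (\<tau> n t) (f t) < e"
    proof eventually_elim
      case (elim n)
      then show ?case unfolding dist_real_def using \<tau>(3)[OF elim(2)] by (meson le_less_trans)
    qed
  qed
  with \<tau> show ?thesis by blast
qed

end
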